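(* Consider the following protocol ("Algorithm 3") for the two-party edge-partition model. Alice and Bob choose a uniformly random permutation $\pi$ of $[n]$ with public randomness and iterate over the vertices in the order of $\pi$. For the current vertex $v$, let $m=\Delta+1$, let $X\subseteq[m]$ be the set of colors already assigned to vertices of $N_A(v)$ (known to Alice) and $Y\subseteq[m]$ the set of colors already assigned to vertices of $N_B(v)$ (known to Bob); they color $v$ with an element of $[m]\setminus(X\cup Y)$ found by the following subroutine ("Algorithm 2"): for $\tilde k=m,\,m/2,\,m/4,\dots,1$ (exponentially decreasing guesses) they (a) choose $S\subseteq[m]$ using public randomness by including each element independently with probability $p=\min\{1,150m/\tilde k^2\}$; (b) Alice sends $|S\cap X|$ and Bob sends $|S\cap Y|$; if $|S\cap X|+|S\cap Y|\ge|S|$ they continue with the next value of $\tilde k$; otherwise (c) they run a deterministic binary search on $T:=S$: while $|T|>1$, split $T$ into two halves $L$ and $R=T\setminus L$, Alice sends $|X\cap L|$ and Bob sends $|Y\cap L|$, and they replace $T$ by $L$ if $|X\cap L|+|Y\cap L|<|L|$ and by $R$ otherwise; the final single element of $T$ is returned and assigned to $v$. Let $c>0$ be a constant. Then, when $\Delta\ge\frac{\sqrt n}{c\log^3 n}$, this protocol communicates $O(n\log^*\Delta)$ bits with probability at least $1-e^{-\Theta\left(\sqrt n/\log^5 n\right)}$.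
   Context: Two-party edge-partition model: the input is an undirected graph $G=(V,E)$ on vertex set $[n]$ with maximum degree $\Delta$; $E$ is partitioned into disjoint sets $E_A$ (Alice's) and $E_B$ (Bob's); both know $n$ and $\Delta$ and share public randomness. $N_A(v)$, $N_B(v)$ denote the neighborhoods of $v$ in $(V,E_A)$ and $(V,E_B)$. Cost is the number of bits communicated; probability is over the public randomness. $\log^* x$ is the number of times the logarithm must be iterated starting from $x$ before reaching a value at most $1$. *)

theory Defs
  imports "HOL-Probability.Probability" "HOL-Library.Landau_Symbols"
    "HOL-Combinatorics.Multiset_Permutations"
begin

section \<open>Graphs on the vertex set $[n]$\<close>

definition simple_graph :: "nat \<Rightarrow> nat set set \<Rightarrow> bool" where
  "simple_graph n E \<longleftrightarrow> (\<forall>e\<in>E. e \<subseteq> {1..n} \<and> card e = 2)"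

definition nbhd :: "nat set set \<Rightarrow> nat \<Rightarrow> nat set" where
  "nbhd E v = {u. {u, v} \<in> E}"

definition max_degree :: "nat \<Rightarrow> nat set set \<Rightarrow> nat" where
  "max_degree n E = Max ((\<lambda>v. card (nbhd E v)) ` {1..n})"

definition log_star :: "real \<Rightarrow> nat" where
  "log_star x = (LEAST k. ((log 2) ^^ k) x \<le> 1)"


section \<open>The protocol\<close>

text \<open>
  Every message is the size of a subset of a set \<open>K\<close> that is known to both parties, that is, a
  number in \<open>{0..card K}\<close>. It is sent in binary with the fixed length sufficient for all these
  values, so that no delimiters are needed.
\<close>

definition msg_bits :: "nat set \<Rightarrow> nat" where
  "msg_bits K = nat \<lceil>log 2 (real (card K) + 1)\<rceil>"

text \<open>
  The protocol does not fix how a set is split into two halves. We use an arbitrary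
  deterministic rule \<open>h\<close>, agreed on in advance, which maps \<open>T\<close> to its half \<open>L\<close>;
  for odd cardinalities either rounding is allowed.
\<close>

definition halving :: "(nat set \<Rightarrow> nat set) \<Rightarrow> bool" where
  "halving h \<longleftrightarrow> (\<forall>T. finite T \<longrightarrow>
     h T \<subseteq> T \<and> (card (h T) = card T div 2 \<or> card (h T) = (card T + 1) div 2))"

text \<open>
  The last argument counts the bits communicated so far; the result is the color found together
  with the total number of bits. The recursion terminates for finite \<open>T\<close> if \<open>halving h\<close>.
\<close>

partial_function (tailrec) binary_search ::
  "(nat set \<Rightarrow> nat set) \<Rightarrow> nat set \<Rightarrow> nat set \<Rightarrow> nat set \<Rightarrow> nat \<Rightarrow> nat \<times> nat"
where
  "binary_search h X Y T b =
     (if card T > 1 then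
        (let L = h T; R = T - L; b' = b + 2 * msg_bits L in
         if card (X \<inter> L) + card (Y \<inter> L) < card L
         then binary_search h X Y L b'
         else binary_search h X Y R b')
      else (the_elem T, b))"

definition random_subset :: "nat \<Rightarrow> real \<Rightarrow> nat set pmf" where
  "random_subset m p =
     map_pmf (\<lambda>f. {i\<in>{1..m}. f i}) (Pi_pmf {1..m} False (\<lambda>_. bernoulli_pmf p))"

text \<open>
  The guesses are $m, m/2, m/4, \ldots$, cut off at \<open>1\<close> in case \<open>m\<close> is not a power of two.
\<close>

definition guesses :: "nat \<Rightarrow> real list" where
  "guesses m = map (\<lambda>i. max 1 (real m / 2 ^ i)) [0..<nat \<lceil>log 2 (real m)\<rceil> + 1]"

text \<open>
  The result is the color found together with the number of bits communicated.
  The case of an exhausted list of guesses is a dummy: for the last guess \<open>1\<close> we have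
  \<open>p = 1\<close>, hence \<open>S = {1..m}\<close>, and the search succeeds because \<open>card X + card Y < m\<close> in the
  protocol.
\<close>

fun find_color ::
  "(nat set \<Rightarrow> nat set) \<Rightarrow> nat \<Rightarrow> nat set \<Rightarrow> nat set \<Rightarrow> real list \<Rightarrow> (nat \<times> nat) pmf"
where
  "find_color h m X Y [] = return_pmf (undefined, 0)"
| "find_color h m X Y (k # ks) =
     do {
       S \<leftarrow> random_subset m (min 1 (150 * real m / k\<^sup>2));
       let b = 2 * msg_bits S;
       if card (S \<inter> X) + card (S \<inter> Y) \<ge> card S
       then do {
         (a, b') \<leftarrow> find_color h m X Y ks;
         return_pmf (a, b + b')
       }
       else return_pmf (binary_search h X Y S b)
     }"

text \<open>
  \<open>\<phi>\<close> is the partial coloring constructed so far; the result is the final coloring together with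
  the number of bits communicated.
\<close>

fun color_vertices ::
  "(nat set \<Rightarrow> nat set) \<Rightarrow> nat \<Rightarrow> nat set set \<Rightarrow> nat set set \<Rightarrow> nat list \<Rightarrow> (nat \<rightharpoonup> nat)
     \<Rightarrow> ((nat \<rightharpoonup> nat) \<times> nat) pmf"
where
  "color_vertices h m EA EB [] \<phi> = return_pmf (\<phi>, 0)"
| "color_vertices h m EA EB (v # vs) \<phi> =
     do {
       let X = {a. \<exists>u\<in>nbhd EA v. \<phi> u = Some a};
       let Y = {a. \<exists>u\<in>nbhd EB v. \<phi> u = Some a};
       (a, b) \<leftarrow> find_color h m X Y (guesses m);
       (\<phi>', b') \<leftarrow> color_vertices h m EA EB vs (\<phi>(v \<mapsto> a));
       return_pmf (\<phi>', b + b')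
     }"

definition coloring_protocol ::
  "(nat set \<Rightarrow> nat set) \<Rightarrow> nat \<Rightarrow> nat \<Rightarrow> nat set set \<Rightarrow> nat set set \<Rightarrow> ((nat \<rightharpoonup> nat) \<times> nat) pmf"
where
  "coloring_protocol h n \<Delta> EA EB =
     do {
       \<pi> \<leftarrow> pmf_of_set (permutations_of_set {1..n});
       color_vertices h (\<Delta> + 1) EA EB \<pi> Map.empty
     }"

end

theory Submission
  imports Defs "HOL-Real_Asymp.Real_Asymp"
begin

text \<open>
  Let \<open>m = \<Delta> + 1\<close> and call \<open>k\<close>, the value of \<open>m\<close> minus the number of neighbors colored before, the
  slack of a vertex. A guess below \<open>k\<close> succeeds with probability at least \<open>2/3\<close>, and the stage with
  guess \<open>m / 2^i\<close> works on about \<open>4^i\<close> colors and so costs \<open>O((i + 1)^2)\<close> bits, which is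
  crudely \<open>O(2^(i/2))\<close>. Hence a vertex of slack \<open>k\<close> has expected cost \<open>O(sqrt (m / k))\<close>.
  With probability \<open>1 - exp (- \<Omega>(\<Delta> / (log n)^2))\<close> over the random order, whenever \<open>l\<close> vertices
  remain and \<open>l \<ge> n / (log n)^2\<close>, the slack of the current vertex is at least \<open>m l / (16 n)\<close>: a
  vertex of degree at least \<open>m / 2\<close> has proportionally many neighbors among the last \<open>l\<close> vertices,
  and a vertex of smaller degree has slack \<open>m / 2\<close> anyway. As \<open>\<Sum>l\<le>n. sqrt (n / l) = O(n)\<close>, these
  vertices cost \<open>O(n)\<close> bits in expectation; the last \<open>n / (log n)^2\<close> vertices cost
  \<open>O((log n)^2)\<close> bits each in the worst case. An exponential moment with parameter of order
  \<open>1 / (log n)^2\<close> shows concentration. So the cost is even \<open>O(n)\<close>, and \<open>log_star\<close> is only used to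
  be at least 1.
\<close>

section \<open>Binary search\<close>

lemma msg_bits_le:
  assumes "card K < 2 ^ j"
  shows "msg_bits K \<le> j"
proof -
  have "real (card K) + 1 \<le> 2 ^ j"
    using assms by (metis Suc_leI of_nat_Suc of_nat_le_iff of_nat_numeral of_nat_power add.commute)
  then have "log 2 (real (card K) + 1) \<le> real j"
    by (simp add: log_le_iff powr_realpow)
  then show ?thesis
    unfolding msg_bits_def by (simp add: ceiling_le_iff)
qed

lemma card_less_two_power_msg_bits: "card K < 2 ^ msg_bits K"
proof -
  have "log 2 (real (card K) + 1) \<le> real (msg_bits K)"
    unfolding msg_bits_def by linarith
  then have "real (card K) + 1 \<le> 2 ^ msg_bits K"
    by (simp add: log_le_iff powr_realpow)
  then have "real (card K) < 2 ^ msg_bits K"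
    by linarith
  then show ?thesis
    by (metis of_nat_less_iff of_nat_numeral of_nat_power)
qed

lemma msg_bits_mono: "finite B \<Longrightarrow> A \<subseteq> B \<Longrightarrow> msg_bits A \<le> msg_bits B"
  by (meson card_less_two_power_msg_bits card_mono le_less_trans msg_bits_le)

lemma halving_card_le:
  assumes "halving h" "finite T"
  shows "h T \<subseteq> T" "card (h T) \<le> (card T + 1) div 2" "card (T - h T) \<le> (card T + 1) div 2"
proof -
  have *: "h T \<subseteq> T" "card (h T) = card T div 2 \<or> card (h T) = (card T + 1) div 2"
    using assms unfolding halving_def by blast+
  then have "card (T - h T) = card T - card (h T)"
    using assms(2) by (meson card_Diff_subset finite_subset)
  then show "h T \<subseteq> T" "card (h T) \<le> (card T + 1) div 2" "card (T - h T) \<le> (card T + 1) div 2"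
    using * by auto
qed

text \<open>Even with rounding up, both halves of a set of at most \<open>2^(j+1)\<close> elements
  have at most \<open>2^j\<close>. Hence \<open>j\<close> rounds suffice, each with two messages of
  at most \<open>j\<close> bits, whichever branch is taken.\<close>

lemma binary_search_cost:
  assumes "halving h" "finite T" "card T \<le> 2 ^ j"
  shows "snd (binary_search h X Y T b) \<le> b + 2 * j * j"
  using assms(2,3)
proof (induction j arbitrary: T b)
  case 0
  then show ?case
    by (subst binary_search.simps) simp
next
  case (Suc j)
  note half = halving_card_le[OF assms(1) Suc.prems(1)]
  have le: "card (h T) \<le> 2 ^ j" "card (T - h T) \<le> 2 ^ j"
    using half Suc.prems(2) by auto
  have fin: "finite (h T)" "finite (T - h T)"
    using half(1) Suc.prems(1) finite_subset by auto
  have "card (h T) < 2 ^ Suc j"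
    using le(1) by (rule le_less_trans) simp
  then have "msg_bits (h T) \<le> Suc j"
    by (rule msg_bits_le)
  then have "b + 2 * msg_bits (h T) + 2 * j * j \<le> b + 2 * Suc j * Suc j"
    by (simp add: algebra_simps)
  then show ?case
    using Suc.IH[OF fin(1) le(1), of "b + 2 * msg_bits (h T)"]
      Suc.IH[OF fin(2) le(2), of "b + 2 * msg_bits (h T)"]
    by (subst binary_search.simps) (auto simp: Let_def)
qed

text \<open>The two messages that test the guess are absorbed into the quadratic cost of the search,
  as an integer is at most its square.\<close>

lemma successful_guess_cost:
  assumes "halving h" "finite S"
  shows "snd (binary_search h X Y S (2 * msg_bits S)) \<le> 4 * (msg_bits S)\<^sup>2"
proof -
  have "card S \<le> 2 ^ msg_bits S"
    using card_less_two_power_msg_bits[of S] by simp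
  from binary_search_cost[OF assms this, of X Y "2 * msg_bits S"]
  have "snd (binary_search h X Y S (2 * msg_bits S)) \<le> 2 * msg_bits S + 2 * (msg_bits S)\<^sup>2"
    by (simp add: power2_eq_square mult.assoc)
  also have "\<dots> \<le> 4 * (msg_bits S)\<^sup>2"
    by (cases "msg_bits S") (auto simp: power2_eq_square)
  finally show ?thesis .
qed

section \<open>Expectations over finitely supported distributions\<close>

lemma expectation_bind_finite:
  fixes g :: "'b \<Rightarrow> real"
  assumes "finite (set_pmf p)" "\<And>x. x \<in> set_pmf p \<Longrightarrow> finite (set_pmf (f x))"
  shows "measure_pmf.expectation (bind_pmf p f) g
    = measure_pmf.expectation p (\<lambda>x. measure_pmf.expectation (f x) g)"
  using assms
  by (subst pmf_expectation_bind[of "set_pmf p"]; (subst integral_measure_pmf[of "set_pmf p"])?) auto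

lemma expectation_mono_finite:
  fixes f g :: "'a \<Rightarrow> real"
  assumes "finite (set_pmf p)" "\<And>x. x \<in> set_pmf p \<Longrightarrow> f x \<le> g x"
  shows "measure_pmf.expectation p f \<le> measure_pmf.expectation p g"
  using assms
  by (intro integral_mono_AE) (auto simp: AE_measure_pmf_iff integrable_measure_pmf_finite)

text \<open>Markov's inequality, in the form used for exponential moments: \<open>f\<close>
  dominates the indicator of \<open>A\<close> on the support.\<close>

lemma prob_le_expectation:
  assumes "finite (set_pmf p)" "\<And>x. x \<in> set_pmf p \<Longrightarrow> 0 \<le> f x"
    "\<And>x. x \<in> set_pmf p \<Longrightarrow> x \<in> A \<Longrightarrow> 1 \<le> f x"
  shows "measure_pmf.prob p A \<le> measure_pmf.expectation p f"
proof -
  have "measure_pmf.prob p A = measure_pmf.expectation p (indicator A)"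
    by simp
  also have "\<dots> \<le> measure_pmf.expectation p f"
    using assms by (intro expectation_mono_finite) (auto simp: indicator_def)
  finally show ?thesis .
qed

section \<open>Random color samples\<close>

lemma finite_set_random_subset [simp]: "finite (set_pmf (random_subset m p))"
  unfolding random_subset_def by (rule finite_subset[of _ "Pow {1..m}"]) auto

lemma set_random_subset: "S \<in> set_pmf (random_subset m p) \<Longrightarrow> S \<subseteq> {1..m}"
  unfolding random_subset_def by auto

lemma finite_set_Pi_pmf:
  fixes p :: "'a \<Rightarrow> 'b :: finite pmf"
  assumes "finite A"
  shows "finite (set_pmf (Pi_pmf A d p))"
  by (rule finite_subset[OF set_Pi_pmf_subset'[OF assms]]) (intro finite_PiE_dflt assms, simp)

lemma expectation_card_random_subset:
  assumes "0 \<le> p" "p \<le> 1"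
  shows "measure_pmf.expectation (random_subset m p) (\<lambda>S. real (card S)) = p * real m"
proof -
  let ?P = "Pi_pmf {1..m} False (\<lambda>_. bernoulli_pmf p)"
  have fin: "finite (set_pmf ?P)"
    by (rule finite_set_Pi_pmf) simp
  have comp: "measure_pmf.expectation ?P (\<lambda>f. of_bool (f i)) = p" if "i \<in> {1..m}" for i
  proof -
    have "measure_pmf.expectation ?P (\<lambda>f. of_bool (f i))
        = measure_pmf.expectation (map_pmf (\<lambda>f. f i) ?P) (of_bool :: bool \<Rightarrow> real)"
      by simp
    also have "map_pmf (\<lambda>f. f i) ?P = bernoulli_pmf p"
      using that by (subst Pi_pmf_component) auto
    finally show ?thesis
      using assms by simp
  qed
  have "measure_pmf.expectation (random_subset m p) (\<lambda>S. real (card S))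
      = measure_pmf.expectation ?P (\<lambda>f. real (card {i\<in>{1..m}. f i}))"
    unfolding random_subset_def by simp
  also have "(\<lambda>f. real (card {i\<in>{1..m}. f i})) = (\<lambda>f. \<Sum>i=1..m. of_bool (f i))"
    by (simp add: sum.If_cases of_bool_def Int_def fun_eq_iff)
  also have "measure_pmf.expectation ?P (\<lambda>f. \<Sum>i=1..m. of_bool (f i) :: real)
      = (\<Sum>i=1..m. measure_pmf.expectation ?P (\<lambda>f. of_bool (f i)))"
    by (intro Bochner_Integration.integral_sum integrable_measure_pmf_finite fin)
  also have "\<dots> = p * real m"
    using comp by simp
  finally show ?thesis .
qed

section \<open>Failure probability of a guess\<close>

lemma exp_le_quadratic:
  fixes y :: real
  assumes "\<bar>y\<bar> \<le> 1"
  shows "exp y \<le> 1 + y + y\<^sup>2"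
proof (cases "0 \<le> y")
  case True
  then show ?thesis
    using exp_bound assms by simp
next
  case False
  \<comment> \<open>For negative arguments, \<open>1 - z + z^2\<close> is compared with
    \<open>1 / exp z\<close>: its product with the quadratic Taylor polynomial, a lower bound of
    \<open>exp z\<close>, is at least 1.\<close>
  define z where "z = - y"
  have z: "0 \<le> z" "z \<le> 1"
    using False assms by (auto simp: z_def)
  have "(1 + z + z\<^sup>2 / 2) * (1 - z + z\<^sup>2) = 1 + z\<^sup>2 / 2 + z ^ 3 / 2 + z ^ 4 / 2"
    by (simp add: field_simps power2_eq_square power3_eq_cube power4_eq_xxxx)
  then have "1 \<le> (1 + z + z\<^sup>2 / 2) * (1 - z + z\<^sup>2)"
    using z by simp
  also have "\<dots> \<le> exp z * (1 - z + z\<^sup>2)"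
    using z exp_lower_Taylor_quadratic[of z] by (intro mult_right_mono) auto
  finally show ?thesis
    by (simp add: z_def exp_minus field_simps)
qed

text \<open>A Chernoff bound with parameter \<open>t = k / (2m)\<close> for the number of elements of the sample
  \<open>S\<close> minus the numbers of elements used by the two parties.\<close>

lemma guess_failure_prob:
  assumes m: "0 < m" and k: "0 < k" "card X + card Y + k \<le> m" and fin: "finite X" "finite Y"
    and p: "0 \<le> p" "p \<le> 1"
  shows "measure_pmf.prob (random_subset m p) {S. card S \<le> card (S \<inter> X) + card (S \<inter> Y)}
    \<le> exp (- (p * (real k)\<^sup>2 / (4 * real m)))"
proof -
  let ?P = "Pi_pmf {1..m} False (\<lambda>_. bernoulli_pmf p)"
  have finP: "finite (set_pmf ?P)"
    by (rule finite_set_Pi_pmf) simp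
  \<comment> \<open>This \<open>t\<close> minimizes \<open>m t^2 - t k\<close>, with value
    \<open>- k^2 / (4 m)\<close>. The weight \<open>w\<close> is 1, 0 or -1 for a color in none, one
    or both of \<open>X\<close> and \<open>Y\<close>, so a failure means that the weights in
    \<open>S\<close> sum to at most 0.\<close>
  define t where "t = real k / (2 * real m)"
  define w :: "nat \<Rightarrow> real" where "w = (\<lambda>i. 1 - of_bool (i \<in> X) - of_bool (i \<in> Y))"
  have t: "0 < t" "t \<le> 1"
    using m k by (auto simp: t_def)
  have w: "\<bar>w i\<bar> \<le> 1" for i
    by (auto simp: w_def)
  have tw: "\<bar>t * w i\<bar> \<le> 1" for i
    using w[of i] t mult_mono[of t 1 "\<bar>w i\<bar>" 1] by (simp add: abs_mult)
  have sum_w: "sum w S = real (card S) - real (card (S \<inter> X)) - real (card (S \<inter> Y))"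
    if "finite S" for S
    using that by (simp add: w_def sum_subtractf sum.If_cases of_bool_def)
  have "measure_pmf.prob (random_subset m p) {S. card S \<le> card (S \<inter> X) + card (S \<inter> Y)}
      \<le> measure_pmf.expectation (random_subset m p) (\<lambda>S. exp (- t * sum w S))"
  proof (rule prob_le_expectation)
    fix S assume S: "S \<in> set_pmf (random_subset m p)"
      "S \<in> {S. card S \<le> card (S \<inter> X) + card (S \<inter> Y)}"
    have "finite S"
      using set_random_subset[OF S(1)] finite_subset by blast
    from sum_w[OF this] have "sum w S \<le> 0"
      using S(2) by simp
    then show "1 \<le> exp (- t * sum w S)"
      using t by (simp add: mult_nonneg_nonpos)
  qed auto
  also have "\<dots> = measure_pmf.expectation ?P (\<lambda>f. exp (- t * sum w {i\<in>{1..m}. f i}))"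
    unfolding random_subset_def by simp
  also have "(\<lambda>f. exp (- t * sum w {i\<in>{1..m}. f i}))
      = (\<lambda>f. \<Prod>i=1..m. if f i then exp (- t * w i) else 1)"
  proof
    fix f
    have "sum w {i\<in>{1..m}. f i} = (\<Sum>i=1..m. if f i then w i else 0)"
      by (rule sum.inter_filter) simp
    then show "exp (- t * sum w {i\<in>{1..m}. f i}) = (\<Prod>i=1..m. if f i then exp (- t * w i) else 1)"
      by (auto simp add: sum_distrib_left exp_sum sum_negf[symmetric] intro!: prod.cong)
  qed
  also have "measure_pmf.expectation ?P \<dots>
      = (\<Prod>i=1..m. measure_pmf.expectation (bernoulli_pmf p) (\<lambda>b. if b then exp (- t * w i) else 1))"
    by (rule expectation_prod_Pi_pmf) (auto intro!: integrable_measure_pmf_finite)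
  \<comment> \<open>In each factor, \<open>exp\<close> is bounded by its quadratic majorant,
    \<open>w^2\<close> by 1, and finally \<open>1 + x\<close> by \<open>exp x\<close>.\<close>
  also have "\<dots> \<le> (\<Prod>i=1..m. exp (p * (t\<^sup>2 - t * w i)))"
  proof (intro prod_mono conjI)
    fix i
    show "0 \<le> measure_pmf.expectation (bernoulli_pmf p) (\<lambda>b. if b then exp (- t * w i) else 1)"
      by (rule integral_nonneg_AE) auto
    have "exp (- t * w i) \<le> 1 + (- t * w i) + (- t * w i)\<^sup>2"
      using tw[of i] by (intro exp_le_quadratic) simp
    also have "(- t * w i)\<^sup>2 \<le> t\<^sup>2"
      using w[of i] by (simp add: power_mult_distrib abs_square_le_1 mult_left_le)
    finally have "p * exp (- t * w i) \<le> p * (1 + (t\<^sup>2 - t * w i))"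
      using p by (intro mult_left_mono) auto
    then have "p * exp (- t * w i) + (1 - p) \<le> 1 + p * (t\<^sup>2 - t * w i)"
      by (simp add: algebra_simps)
    also have "\<dots> \<le> exp (p * (t\<^sup>2 - t * w i))"
      by (rule exp_ge_add_one_self)
    finally show "measure_pmf.expectation (bernoulli_pmf p) (\<lambda>b. if b then exp (- t * w i) else 1)
        \<le> exp (p * (t\<^sup>2 - t * w i))"
      using p by (simp add: mult.commute)
  qed
  also have "\<dots> = exp (p * (real m * t\<^sup>2 - t * sum w {1..m}))"
    by (simp add: exp_sum[symmetric] sum_distrib_left sum_subtractf right_diff_distrib)
  also have "\<dots> \<le> exp (- (p * (real k)\<^sup>2 / (4 * real m)))"
  proof -
    \<comment> \<open>\<open>X\<close> and \<open>Y\<close> may contain elements outside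
      \<open>{1..m}\<close>; discarding them only increases the total weight.\<close>
    have "real (card ({1..m} \<inter> X)) \<le> real (card X)" "real (card ({1..m} \<inter> Y)) \<le> real (card Y)"
      using fin by (simp_all add: card_mono)
    then have "real k \<le> sum w {1..m}"
      using k(2) by (simp add: sum_w)
    then have "real m * t\<^sup>2 - t * sum w {1..m} \<le> real m * t\<^sup>2 - t * real k"
      using t by simp
    also have "\<dots> = - ((real k)\<^sup>2 / (4 * real m))"
      using m by (simp add: t_def power2_eq_square field_simps)
    finally have "p * (real m * t\<^sup>2 - t * sum w {1..m}) \<le> p * (- ((real k)\<^sup>2 / (4 * real m)))"
      using p by (intro mult_left_mono)
    then show ?thesis
      by simp
  qed
  finally show ?thesis .
qed

lemma random_subset_1: "random_subset m 1 = return_pmf {1..m}"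
proof -
  have "bernoulli_pmf 1 = return_pmf True"
    by (rule pmf_eqI) (metis pmf_bernoulli_False pmf_bernoulli_True pmf_return
        diff_self le_numeral_extra(4) indicator_simps singletonD singletonI zero_le_one)
  then have "random_subset m 1 = map_pmf (\<lambda>f. {i\<in>{1..m}. f i})
      (return_pmf (\<lambda>i. if i \<in> {1..m} then True else False))"
    unfolding random_subset_def by (simp add: Pi_pmf_return_pmf)
  also have "\<dots> = return_pmf {1..m}"
    by (simp add: set_eq_iff)
  finally show ?thesis .
qed

text \<open>If the sampling probability is capped at 1, the sample is the whole palette and the
  \<open>k\<close> free colors rule out failure. Otherwise the Chernoff exponent is
  \<open>150 k^2 / (4 g^2)\<close>, at least \<open>75 / 2\<close>; an exponent of 2 already gives
  \<open>1 / 3\<close>.\<close>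

lemma small_guess_failure_prob:
  assumes k: "card X + card Y + k \<le> m" "1 \<le> g" "g \<le> real k" and fin: "finite X" "finite Y"
  shows "measure_pmf.prob (random_subset m (min 1 (150 * real m / g\<^sup>2)))
    {S. card S \<le> card (S \<inter> X) + card (S \<inter> Y)} \<le> 1 / 3"
proof (cases "150 * real m / g\<^sup>2 \<ge> 1")
  case True
  have "card ({1..m} \<inter> X) \<le> card X" "card ({1..m} \<inter> Y) \<le> card Y"
    using fin by (simp_all add: card_mono)
  moreover have "0 < k"
    using k by (cases k) auto
  ultimately have "\<not> card {1..m} \<le> card ({1..m} \<inter> X) + card ({1..m} \<inter> Y)"
    using k(1) by simp
  moreover have "min 1 (150 * real m / g\<^sup>2) = 1"
    using True by simp
  ultimately show ?thesis
    by (simp only: random_subset_1) (simp add: indicator_def)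
next
  case False
  have "0 < real k"
    using k by linarith
  then have k0: "0 < k"
    by simp
  then have m: "0 < m"
    using k by simp
  have p: "min 1 (150 * real m / g\<^sup>2) = 150 * real m / g\<^sup>2"
    using False by simp
  have "measure_pmf.prob (random_subset m (150 * real m / g\<^sup>2))
      {S. card S \<le> card (S \<inter> X) + card (S \<inter> Y)}
      \<le> exp (- (150 * real m / g\<^sup>2 * (real k)\<^sup>2 / (4 * real m)))"
    using k k0 m fin False by (intro guess_failure_prob) auto
  also have "- (150 * real m / g\<^sup>2 * (real k)\<^sup>2 / (4 * real m)) = - (75 / 2 * ((real k)\<^sup>2 / g\<^sup>2))"
    using m by (simp add: field_simps)
  also have "exp (- (75 / 2 * ((real k)\<^sup>2 / g\<^sup>2))) \<le> exp (- 2)"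
  proof -
    have "g\<^sup>2 \<le> (real k)\<^sup>2"
      using k by (intro power_mono) auto
    then have "1 \<le> (real k)\<^sup>2 / g\<^sup>2"
      using k by (simp add: field_simps)
    then show ?thesis
      by simp
  qed
  also have "exp (- 2 :: real) \<le> 1 / 3"
    using exp_ge_add_one_self[of "2 :: real"] by (simp add: exp_minus field_simps)
  finally show ?thesis
    unfolding p .
qed

section \<open>The cost of coloring one vertex\<close>

text \<open>With \<open>z\<close> twice \<open>card S + 1\<close>, the factor 2 absorbs the ceiling.
  Writing \<open>z = y^8\<close> turns \<open>log 2 z\<close> into a multiple of
  \<open>ln y\<close>, which is below \<open>y\<close>; the square is then of the order of the
  fourth root of \<open>z\<close>.\<close>

lemma square_msg_bits_le:
  assumes "finite S"
  shows "(real (msg_bits S))\<^sup>2 \<le> 144 * sqrt (sqrt (2 * (real (card S) + 1)))"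
proof -
  define z where "z = 2 * (real (card S) + 1)"
  define y where "y = sqrt (sqrt (sqrt z))"
  have z: "1 \<le> z" "0 < z"
    by (auto simp: z_def)
  have y: "1 \<le> y" "y\<^sup>2 = sqrt (sqrt z)"
    using z by (auto simp: y_def)
  have "z = y ^ 8"
  proof -
    have "y ^ 8 = ((y\<^sup>2)\<^sup>2)\<^sup>2"
      by (simp flip: power_mult)
    then show ?thesis
      using z by (simp add: y_def)
  qed
  then have "ln z = 8 * ln y"
    using y by (simp add: ln_realpow)
  also have "\<dots> \<le> 8 * y"
    using y ln_le_minus_one[of y] by simp
  finally have "log 2 z \<le> 8 * y / ln 2"
    by (simp add: log_def divide_right_mono)
  also have "\<dots> \<le> 8 * y / (2 / 3)"
    using y ln2_ge_two_thirds by (intro divide_left_mono) auto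
  finally have "log 2 z \<le> 12 * y"
    by simp
  moreover have "log 2 z = 1 + log 2 (real (card S) + 1)"
    unfolding z_def by (subst log_mult) auto
  moreover have "real (msg_bits S) \<le> log 2 (real (card S) + 1) + 1"
  proof -
    have "0 \<le> log 2 (real (card S) + 1)"
      by simp
    then show ?thesis
      unfolding msg_bits_def by linarith
  qed
  ultimately have "real (msg_bits S) \<le> 12 * y"
    by linarith
  then have "(real (msg_bits S))\<^sup>2 \<le> (12 * y)\<^sup>2"
    by (intro power_mono) auto
  also have "\<dots> = 144 * sqrt (sqrt z)"
    using y(2) by (simp add: power_mult_distrib)
  finally show ?thesis
    unfolding z_def .
qed

text \<open>The right-hand side is the tangent of the concave square root at \<open>s^2\<close>. It
  serves as an explicit form of Jensen's inequality.\<close>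

lemma sqrt_le_tangent:
  fixes a s :: real
  assumes "0 \<le> a" "0 < s"
  shows "sqrt a \<le> (a / s + s) / 2"
proof -
  have "0 \<le> (sqrt a - s)\<^sup>2 / s"
    using assms by simp
  also have "\<dots> = a / s + s - 2 * sqrt a"
    using assms by (simp add: power2_diff power2_eq_square field_simps)
  finally show ?thesis
    by simp
qed

lemma sqrt_two_power_squared: "(sqrt 2 ^ i)\<^sup>2 = (2 :: real) ^ i"
  by (metis power_mult mult.commute real_sqrt_pow2 zero_le_numeral)

text \<open>The mean sample size is at most \<open>150 s^4\<close> with
  \<open>s = sqrt 2 ^ i\<close>. Tangents at \<open>s^2\<close> and \<open>s^4\<close> replace the
  fourth root of the size by a linear function of it, so only this mean enters. The constant is
  \<open>72 * 150 + 72 + 108\<close>, rounded up.\<close>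

lemma expectation_square_msg_bits_le:
  fixes g :: real
  assumes m: "0 < m" and g: "real m / 2 ^ i \<le> g"
  shows "measure_pmf.expectation (random_subset m (min 1 (150 * real m / g\<^sup>2)))
    (\<lambda>S. (real (msg_bits S))\<^sup>2) \<le> 11000 * sqrt 2 ^ i"
proof -
  define p where "p = min 1 (150 * real m / g\<^sup>2)"
  define s where "s = sqrt 2 ^ i"
  have s: "0 < s" "2 ^ i = s\<^sup>2"
    by (simp_all add: s_def sqrt_two_power_squared)
  have g0: "0 < g"
    using m by (intro less_le_trans[OF _ g]) simp
  have p: "0 \<le> p" "p \<le> 1"
    using g0 by (auto simp: p_def)
  have "p * real m \<le> 150 * real m / g\<^sup>2 * real m"
    by (intro mult_right_mono) (auto simp: p_def)
  also have "\<dots> = 150 * (real m / g)\<^sup>2"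
    by (simp add: power2_eq_square)
  also have "\<dots> \<le> 150 * (2 ^ i)\<^sup>2"
    using g g0 by (intro mult_left_mono power_mono) (auto simp: field_simps)
  finally have pm: "p * real m \<le> 150 * (s\<^sup>2)\<^sup>2"
    using s by simp
  have le: "(real (msg_bits S))\<^sup>2 \<le> 72 / s ^ 3 * real (card S) + (72 / s ^ 3 + 108 * s)"
    if "finite S" for S
  proof -
    define z where "z = 2 * (real (card S) + 1)"
    have "sqrt (sqrt z) \<le> (sqrt z / s + s) / 2"
      using s by (intro sqrt_le_tangent) (auto simp: z_def)
    also have "\<dots> \<le> ((z / s\<^sup>2 + s\<^sup>2) / 2 / s + s) / 2"
      using s sqrt_le_tangent[of z "s\<^sup>2"]
      by (intro divide_right_mono add_right_mono) (auto simp: z_def)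
    also have "144 * \<dots> = 72 / s ^ 3 * real (card S) + (72 / s ^ 3 + 108 * s)"
      using s by (simp add: z_def field_simps power2_eq_square power3_eq_cube)
    finally show ?thesis
      using square_msg_bits_le[OF that] unfolding z_def by linarith
  qed
  have "measure_pmf.expectation (random_subset m p) (\<lambda>S. (real (msg_bits S))\<^sup>2)
      \<le> measure_pmf.expectation (random_subset m p)
          (\<lambda>S. 72 / s ^ 3 * real (card S) + (72 / s ^ 3 + 108 * s))"
    by (intro expectation_mono_finite le finite_set_random_subset)
       (meson set_random_subset finite_subset finite_atLeastAtMost)
  also have "\<dots> = 72 / s ^ 3 * (p * real m) + (72 / s ^ 3 + 108 * s)"
    using expectation_card_random_subset[OF p, of m]
    by (subst Bochner_Integration.integral_add) (auto intro!: integrable_measure_pmf_finite)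
  also have "\<dots> \<le> 72 / s ^ 3 * (150 * (s\<^sup>2)\<^sup>2) + (72 * s + 108 * s)"
  proof (intro add_mono mult_left_mono pm)
    have "1 \<le> s"
      by (simp add: s_def)
    then have "1 \<le> s ^ 4"
      by simp
    then have "1 \<le> s * s ^ 3"
      by (simp add: power4_eq_xxxx power3_eq_cube)
    then show "72 / s ^ 3 \<le> 72 * s"
      using s(1) by (simp add: divide_le_eq)
  qed (use s in auto)
  also have "\<dots> = 10980 * s"
    using s by (simp add: field_simps power2_eq_square power3_eq_cube)
  also have "\<dots> \<le> 11000 * s"
    using s by simp
  finally show ?thesis
    unfolding p_def s_def .
qed

lemma finite_set_find_color [simp]: "finite (set_pmf (find_color h m X Y ks))"
proof (induction ks)
  case (Cons k ks)
  then show ?case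
    by (auto simp: Let_def split: prod.splits)
qed simp

text \<open>In the worst case every guess pays for its two test messages, and one binary search
  follows.\<close>

lemma find_color_max_cost:
  assumes "halving h" "ab \<in> set_pmf (find_color h m X Y ks)"
  shows "snd ab \<le> 2 * length ks * msg_bits {1..m} + 4 * (msg_bits {1..m})\<^sup>2"
  using assms(2)
proof (induction ks arbitrary: ab)
  case (Cons k ks)
  then obtain S where S: "S \<in> set_pmf (random_subset m (min 1 (150 * real m / k\<^sup>2)))"
    and ab: "ab \<in> set_pmf (let b = 2 * msg_bits S in
       if card (S \<inter> X) + card (S \<inter> Y) \<ge> card S
       then do {
         (a, b') \<leftarrow> find_color h m X Y ks;
         return_pmf (a, b + b')
       }
       else return_pmf (binary_search h X Y S b))"
    by auto
  have "S \<subseteq> {1..m}"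
    using S by (rule set_random_subset)
  then have bits: "msg_bits S \<le> msg_bits {1..m}" and fin: "finite S"
    by (auto intro!: msg_bits_mono finite_subset[of S])
  show ?case
  proof (cases "card (S \<inter> X) + card (S \<inter> Y) \<ge> card S")
    case True
    then obtain c where "c \<in> set_pmf (find_color h m X Y ks)" "snd ab = 2 * msg_bits S + snd c"
      using ab by (auto simp: Let_def split: prod.splits)
    then show ?thesis
      using Cons.IH[of c] bits by simp
  next
    case False
    then have "snd ab \<le> 4 * (msg_bits S)\<^sup>2"
      using ab successful_guess_cost[OF assms(1) fin, of X Y] by (simp add: Let_def)
    also have "\<dots> \<le> 4 * (msg_bits {1..m})\<^sup>2"
      using bits by simp
    finally show ?thesis
      by simp
  qed
qed simp

abbreviation expected_cost ::
  "(nat set \<Rightarrow> nat set) \<Rightarrow> nat \<Rightarrow> nat set \<Rightarrow> nat set \<Rightarrow> real list \<Rightarrow> real" where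
  "expected_cost h m X Y ks \<equiv>
     measure_pmf.expectation (find_color h m X Y ks) (\<lambda>ab. real (snd ab))"

lemma expected_cost_nonneg: "0 \<le> expected_cost h m X Y ks"
  by (rule integral_nonneg_AE) auto

text \<open>A binary search is charged to the stage whether or not the guess fails. Later guesses
  draw fresh samples, so their expected cost is simply multiplied by the failure
  probability.\<close>

lemma expected_cost_Cons:
  fixes k :: real and m :: nat
  assumes h: "halving h"
  defines "R \<equiv> random_subset m (min 1 (150 * real m / k\<^sup>2))"
  shows "expected_cost h m X Y (k # ks)
    \<le> 4 * measure_pmf.expectation R (\<lambda>S. (real (msg_bits S))\<^sup>2)
      + measure_pmf.prob R {S. card S \<le> card (S \<inter> X) + card (S \<inter> Y)} * expected_cost h m X Y ks"
proof -
  let ?F = "{S. card S \<le> card (S \<inter> X) + card (S \<inter> Y)}"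
  define N where "N S = (let b = 2 * msg_bits S in
       if card (S \<inter> X) + card (S \<inter> Y) \<ge> card S
       then do {
         (a, b') \<leftarrow> find_color h m X Y ks;
         return_pmf (a, b + b')
       }
       else return_pmf (binary_search h X Y S b))" for S
  have finN: "finite (set_pmf (N S))" for S
    by (auto simp: N_def Let_def split: prod.splits)
  have finR: "finite (set_pmf R)"
    by (simp add: R_def)
  have le: "measure_pmf.expectation (N S) (\<lambda>ab. real (snd ab))
      \<le> 4 * (real (msg_bits S))\<^sup>2 + indicator ?F S * expected_cost h m X Y ks"
    if "S \<in> set_pmf R" for S
  proof -
    have fin: "finite S"
      using set_random_subset[of S] that finite_subset unfolding R_def by blast
    show ?thesis
    proof (cases "S \<in> ?F")
      case True
      have "N S = map_pmf (\<lambda>(a, b'). (a, 2 * msg_bits S + b')) (find_color h m X Y ks)"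
        using True by (simp add: N_def Let_def map_pmf_def case_prod_unfold)
      then have "measure_pmf.expectation (N S) (\<lambda>ab. real (snd ab))
          = measure_pmf.expectation (find_color h m X Y ks)
              (\<lambda>ab. 2 * real (msg_bits S) + real (snd ab))"
        by (simp add: case_prod_unfold)
      also have "\<dots> = 2 * real (msg_bits S) + expected_cost h m X Y ks"
        by (subst Bochner_Integration.integral_add) (auto intro!: integrable_measure_pmf_finite)
      also have "2 * real (msg_bits S) \<le> 4 * (real (msg_bits S))\<^sup>2"
        by (cases "msg_bits S") (auto simp: power2_eq_square algebra_simps)
      finally show ?thesis
        using True by simp
    next
      case False
      have "real (snd (binary_search h X Y S (2 * msg_bits S))) \<le> real (4 * (msg_bits S)\<^sup>2)"
        using successful_guess_cost[OF h fin] by (rule of_nat_mono)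
      then show ?thesis
        using False by (simp add: N_def Let_def)
    qed
  qed
  have "expected_cost h m X Y (k # ks)
      = measure_pmf.expectation R (\<lambda>S. measure_pmf.expectation (N S) (\<lambda>ab. real (snd ab)))"
    using finR finN by (simp add: expectation_bind_finite R_def[symmetric] N_def[symmetric])
  also have "\<dots> \<le> measure_pmf.expectation R
      (\<lambda>S. 4 * (real (msg_bits S))\<^sup>2 + indicator ?F S * expected_cost h m X Y ks)"
    by (intro expectation_mono_finite finR le)
  also have "\<dots> = 4 * measure_pmf.expectation R (\<lambda>S. (real (msg_bits S))\<^sup>2)
      + measure_pmf.prob R ?F * expected_cost h m X Y ks"
    using finR
    by (subst Bochner_Integration.integral_add) (auto intro!: integrable_measure_pmf_finite)
  finally show ?thesis .
qed

text \<open>Once the guess has dropped below the slack \<open>k\<close>, each further guess is reached with probability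
  at most \<open>1/3\<close>, which beats the growth rate \<open>sqrt 2\<close> of the stage costs; before that, the stage
  costs form a geometric sum dominated by its last term, which is of order \<open>sqrt (m/k)\<close>.\<close>

lemma expected_cost_guesses_from:
  fixes g :: "nat \<Rightarrow> real" and j m k :: nat
  assumes h: "halving h" and m: "0 < m"
    and k: "card X + card Y + k \<le> m" "0 < k" and fin: "finite X" "finite Y"
    and g: "\<And>i. g i = max 1 (real m / 2 ^ i)"
  defines "A \<equiv> sqrt (real m / real k)"
  shows "expected_cost h m X Y (map g [i..<i + j])
    \<le> 44000 * (if A \<le> sqrt 2 ^ i then 2 * sqrt 2 ^ i else 7 * A - 3 * sqrt 2 ^ i)"
proof (induction j arbitrary: i)
  case 0
  have "0 \<le> (if A \<le> s then 2 * s else 7 * A - 3 * s)" if "0 \<le> s" for s :: real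
    using that by auto
  then show ?case
    by simp
next
  case (Suc j)
  let ?R = "random_subset m (min 1 (150 * real m / (g i)\<^sup>2))"
  let ?q = "measure_pmf.prob ?R {S. card S \<le> card (S \<inter> X) + card (S \<inter> Y)}"
  let ?rest = "expected_cost h m X Y (map g [Suc i..<Suc i + j])"
  define s where "s = sqrt 2 ^ i"
  have s0: "0 < s"
    by (simp add: s_def)
  \<comment> \<open>These bounds on \<open>sqrt 2\<close> close the recursion, in units of 44000 (4
    times 11000). For \<open>A <= s\<close>: \<open>s + 2 w / 3 <= 2 s\<close>. For
    \<open>A > s\<close> the rest must be at most \<open>7 A - 4 s\<close>: either
    \<open>3 w >= 4 s\<close> gives this, or the threshold is crossed and
    \<open>2 w <= 3 s < 7 A - 4 s\<close>.\<close>
  have root: "7 / 5 \<le> sqrt (2 :: real)" "sqrt (2 :: real) \<le> 3 / 2"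
    by (rule real_le_rsqrt, simp add: power2_eq_square)
      (rule real_le_lsqrt, simp_all add: power2_eq_square)
  define w where "w = sqrt 2 * s"
  have root_s: "7 / 5 * s \<le> w" "w \<le> 3 / 2 * s"
    unfolding w_def using root s0 by (auto intro!: mult_right_mono)
  have "real m / 2 ^ i \<le> g i"
    by (simp add: g)
  from expectation_square_msg_bits_le[OF m this]
  have step: "expected_cost h m X Y (map g [i..<i + Suc j]) \<le> 44000 * s + ?q * ?rest"
    using expected_cost_Cons[OF h, of m X Y "g i" "map g [Suc i..<Suc i + j]"]
    by (simp add: upt_conv_Cons s_def del: upt_Suc)
  show ?case
  proof (cases "A \<le> s")
    case True
    \<comment> \<open>\<open>A <= s\<close> means \<open>m / k <= 2^i\<close>, so the guess is at
      most \<open>k\<close>; its cut-off at 1 does no harm because \<open>k\<close> is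
      positive.\<close>
    have "?q \<le> 1 / 3"
    proof (rule small_guess_failure_prob)
      have "A\<^sup>2 \<le> s\<^sup>2"
        using True by (intro power_mono) (auto simp: A_def)
      moreover have "s\<^sup>2 = 2 ^ i"
        by (simp add: s_def sqrt_two_power_squared)
      ultimately have "real m / real k \<le> 2 ^ i"
        by (simp add: A_def)
      then show "g i \<le> real k"
        using k by (simp add: g field_simps)
    qed (use k fin in \<open>auto simp: g\<close>)
    then have "?q * ?rest \<le> 1 / 3 * ?rest"
      by (intro mult_right_mono expected_cost_nonneg)
    moreover have "A \<le> w"
      using True root_s s0 by linarith
    then have "?rest \<le> 44000 * (2 * w)"
      using Suc.IH[of "Suc i"] by (simp add: s_def w_def)
    ultimately have "expected_cost h m X Y (map g [i..<i + Suc j]) \<le> 44000 * (2 * s)"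
      using step root_s by linarith
    then show ?thesis
      using True by (simp add: s_def)
  next
    case False
    have "?q * ?rest \<le> 1 * ?rest"
      by (intro mult_right_mono expected_cost_nonneg) simp
    moreover have "?rest \<le> 44000 * (7 * A - 4 * s)"
    proof (cases "A \<le> w")
      case True
      then have "?rest \<le> 44000 * (2 * w)"
        using Suc.IH[of "Suc i"] by (simp add: s_def w_def)
      then show ?thesis
        using root_s False by simp
    next
      case False
      then have "?rest \<le> 44000 * (7 * A - 3 * w)"
        using Suc.IH[of "Suc i"] by (simp add: s_def w_def)
      then show ?thesis
        using root_s s0 by argo
    qed
    ultimately have "expected_cost h m X Y (map g [i..<i + Suc j]) \<le> 44000 * (7 * A - 3 * s)"
      using step by argo
    then show ?thesis
      using False by (simp add: s_def)
  qed
qed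

lemma expected_cost_guesses:
  assumes "halving h" and k: "card X + card Y + k \<le> m" "0 < k" and "finite X" "finite Y"
  shows "expected_cost h m X Y (guesses m) \<le> 308000 * sqrt (real m / real k)"
proof -
  let ?A = "sqrt (real m / real k)"
  have "expected_cost h m X Y (guesses m)
      \<le> 44000 * (if ?A \<le> sqrt 2 ^ 0 then 2 * sqrt 2 ^ 0 else 7 * ?A - 3 * sqrt 2 ^ 0)"
    using expected_cost_guesses_from[OF assms(1) _ k assms(4,5) refl,
        of 0 "nat \<lceil>log 2 (real m)\<rceil> + 1"] k
    unfolding guesses_def add_0 by linarith
  also have "\<dots> \<le> 44000 * (7 * ?A)"
  proof -
    have "1 \<le> ?A"
      using k by simp
    then show ?thesis
      by simp
  qed
  finally show ?thesis
    by simp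
qed

lemma find_color_guesses_max_cost:
  assumes "halving h" "0 < m" "ab \<in> set_pmf (find_color h m X Y (guesses m))"
  shows "snd ab \<le> 8 * (msg_bits {1..m})\<^sup>2"
proof -
  define J where "J = msg_bits {1..m}"
  have "log 2 (real m) \<le> log 2 (real m + 1)"
    using assms(2) by (subst log_le_cancel_iff) auto
  then have "nat \<lceil>log 2 (real m)\<rceil> \<le> J"
    unfolding J_def msg_bits_def by (intro nat_mono ceiling_mono) simp
  then have "length (guesses m) \<le> J + 1"
    by (simp add: guesses_def)
  then have "2 * length (guesses m) * J \<le> 2 * (J + 1) * J"
    by (intro mult_right_mono mult_left_mono) auto
  moreover have "snd ab \<le> 2 * length (guesses m) * J + 4 * J\<^sup>2"
    unfolding J_def by (rule find_color_max_cost[OF assms(1,3)])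
  moreover have "2 * (J + 1) * J + 4 * J\<^sup>2 \<le> 8 * J\<^sup>2"
    by (cases J) (auto simp: power2_eq_square)
  ultimately show ?thesis
    unfolding J_def by linarith
qed

section \<open>Exponential moment of the total cost\<close>

lemma finite_set_color_vertices [simp]: "finite (set_pmf (color_vertices h m EA EB vs \<phi>))"
proof (induction vs arbitrary: \<phi>)
  case (Cons v vs)
  then show ?case
    by (auto simp: Let_def split: prod.splits)
qed simp

text \<open>The condition on \<open>l\<close> keeps \<open>l\<close> times the cost in
  \<open>[0, 1]\<close> even in the worst case. There \<open>exp y <= 1 + 2 y\<close>, which reduces
  the exponential moment to the mean.\<close>

lemma expectation_exp_find_color:
  assumes h: "halving h" and m: "0 < m" and l: "0 \<le> l" "l * (8 * (real (msg_bits {1..m}))\<^sup>2) \<le> 1"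
  shows "measure_pmf.expectation (find_color h m X Y (guesses m)) (\<lambda>ab. exp (l * real (snd ab)))
    \<le> exp (2 * l * expected_cost h m X Y (guesses m))"
proof -
  let ?P = "find_color h m X Y (guesses m)"
  have le: "exp (l * real (snd ab)) \<le> 1 + 2 * l * real (snd ab)" if "ab \<in> set_pmf ?P" for ab
  proof -
    define y where "y = l * real (snd ab)"
    have "real (snd ab) \<le> real (8 * (msg_bits {1..m})\<^sup>2)"
      using find_color_guesses_max_cost[OF h m that] by (rule of_nat_mono)
    then have "y \<le> l * (8 * (real (msg_bits {1..m}))\<^sup>2)"
      unfolding y_def using l(1) by (intro mult_left_mono) auto
    then have y: "0 \<le> y" "y \<le> 1"
      using l by (auto simp: y_def)
    have "exp y \<le> 1 + y + y\<^sup>2"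
      using y by (intro exp_bound)
    also have "y\<^sup>2 \<le> y"
      using y by (simp add: power2_eq_square mult_left_le)
    finally show ?thesis
      by (simp add: y_def)
  qed
  have "measure_pmf.expectation ?P (\<lambda>ab. exp (l * real (snd ab)))
      \<le> measure_pmf.expectation ?P (\<lambda>ab. 1 + 2 * l * real (snd ab))"
    by (intro expectation_mono_finite le) auto
  also have "\<dots> = 1 + 2 * l * expected_cost h m X Y (guesses m)"
    by (subst Bochner_Integration.integral_add) (auto intro!: integrable_measure_pmf_finite)
  also have "\<dots> \<le> exp (2 * l * expected_cost h m X Y (guesses m))"
    by (rule exp_ge_add_one_self)
  finally show ?thesis .
qed

text \<open>The color sets met at a vertex depend on earlier randomness, so the hypothesis ranges
  over all \<open>X\<close> and \<open>Y\<close> whose sizes respect the number of earlier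
  neighbors. Conditionally on the past, each vertex then contributes a factor at most
  \<open>exp (g i)\<close>, and the factors multiply.\<close>

lemma expectation_exp_color_vertices:
  assumes "\<And>i X Y. i < length vs \<Longrightarrow> finite X \<Longrightarrow> finite Y \<Longrightarrow>
      card X + card Y \<le> card (nbhd (EA \<union> EB) (vs ! i) \<inter> (dom \<phi> \<union> set (take i vs))) \<Longrightarrow>
      measure_pmf.expectation (find_color h m X Y (guesses m)) (\<lambda>ab. exp (l * real (snd ab)))
        \<le> exp (g i)"
    and "EA \<inter> EB = {}" and "\<And>v. finite (nbhd (EA \<union> EB) v)"
  shows "measure_pmf.expectation (color_vertices h m EA EB vs \<phi>) (\<lambda>r. exp (l * real (snd r)))
    \<le> exp (\<Sum>i<length vs. g i)"
  using assms(1)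
proof (induction vs arbitrary: \<phi> g)
  case Nil
  then show ?case
    by simp
next
  case (Cons v vs)
  define X where "X = {a. \<exists>u\<in>nbhd EA v. \<phi> u = Some a}"
  define Y where "Y = {a. \<exists>u\<in>nbhd EB v. \<phi> u = Some a}"
  let ?F = "find_color h m X Y (guesses m)"
  have nb: "nbhd (EA \<union> EB) v = nbhd EA v \<union> nbhd EB v" "nbhd EA v \<inter> nbhd EB v = {}"
    using assms(2) by (auto simp: nbhd_def)
  have fin: "finite (nbhd EA v \<inter> dom \<phi>)" "finite (nbhd EB v \<inter> dom \<phi>)"
    using assms(3)[of v] by (auto simp: nb)
  have X: "X = (\<lambda>u. the (\<phi> u)) ` (nbhd EA v \<inter> dom \<phi>)" and Y: "Y = (\<lambda>u. the (\<phi> u)) ` (nbhd EB v \<inter> dom \<phi>)"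
    by (force simp: X_def Y_def)+
  have "card X + card Y \<le> card (nbhd EA v \<inter> dom \<phi>) + card (nbhd EB v \<inter> dom \<phi>)"
    unfolding X Y by (intro add_mono card_image_le fin)
  also have "\<dots> = card (nbhd (EA \<union> EB) v \<inter> dom \<phi>)"
    using fin nb by (subst card_Un_disjoint[symmetric]) (auto simp: Int_Un_distrib2)
  finally have XY: "card X + card Y \<le> card (nbhd (EA \<union> EB) v \<inter> dom \<phi>)" .
  have first: "measure_pmf.expectation ?F (\<lambda>ab. exp (l * real (snd ab))) \<le> exp (g 0)"
    using Cons.prems[of 0 X Y] XY fin by (simp add: X Y)
  define N where "N = (\<lambda>ab :: nat \<times> nat. map_pmf (\<lambda>r. (fst r, snd ab + snd r))
    (color_vertices h m EA EB vs (\<phi>(v \<mapsto> fst ab))))"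
  have "color_vertices h m EA EB (v # vs) \<phi> = bind_pmf ?F N"
    by (simp add: X_def Y_def N_def Let_def map_pmf_def case_prod_unfold)
  then have "measure_pmf.expectation (color_vertices h m EA EB (v # vs) \<phi>)
        (\<lambda>r. exp (l * real (snd r)))
      = measure_pmf.expectation ?F (\<lambda>ab. measure_pmf.expectation (N ab) (\<lambda>r. exp (l * real (snd r))))"
    by (simp add: expectation_bind_finite N_def)
  also have "\<dots> \<le> measure_pmf.expectation ?F
      (\<lambda>ab. exp (l * real (snd ab)) * exp (\<Sum>i<length vs. g (Suc i)))"
  proof (intro expectation_mono_finite finite_set_find_color)
    fix ab
    have "measure_pmf.expectation (N ab) (\<lambda>r. exp (l * real (snd r)))
        = exp (l * real (snd ab)) * measure_pmf.expectation
            (color_vertices h m EA EB vs (\<phi>(v \<mapsto> fst ab))) (\<lambda>r. exp (l * real (snd r)))"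
      by (simp add: N_def distrib_left exp_add)
    also have "\<dots> \<le> exp (l * real (snd ab)) * exp (\<Sum>i<length vs. g (Suc i))"
    proof (intro mult_left_mono Cons.IH)
      fix i and X Y :: "nat set"
      assume i: "i < length vs" and f: "finite X" "finite Y" and le: "card X + card Y
        \<le> card (nbhd (EA \<union> EB) (vs ! i) \<inter> (dom (\<phi>(v \<mapsto> fst ab)) \<union> set (take i vs)))"
      show "measure_pmf.expectation (find_color h m X Y (guesses m)) (\<lambda>ab. exp (l * real (snd ab)))
        \<le> exp (g (Suc i))"
        \<comment> \<open>Coloring \<open>v\<close> moves it from the list into the domain, so the
          union of domain and prefix is the same set.\<close>
        using Cons.prems[of "Suc i" X Y] i f le by simp
    qed simp
    finally show "measure_pmf.expectation (N ab) (\<lambda>r. exp (l * real (snd r)))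
      \<le> exp (l * real (snd ab)) * exp (\<Sum>i<length vs. g (Suc i))" .
  qed
  also have "\<dots> = measure_pmf.expectation ?F (\<lambda>ab. exp (l * real (snd ab)))
      * exp (\<Sum>i<length vs. g (Suc i))"
    by simp
  also have "\<dots> \<le> exp (g 0) * exp (\<Sum>i<length vs. g (Suc i))"
    using first by (intro mult_right_mono) auto
  also have "\<dots> = exp (\<Sum>i<length (v # vs). g i)"
    by (simp only: exp_add[symmetric] length_Cons sum.lessThan_Suc_shift)
  finally show ?case .
qed

section \<open>Random permutations\<close>

text \<open>The first elements of the permutation are revealed one by one. As long as \<open>B\<close> has been hit
  less than \<open>r\<close> times, the next element hits \<open>B\<close> with conditional probability at least \<open>q\<close>, so
  each step multiplies the conditional expectation of \<open>x\<close> to the number of hits by at most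
  \<open>1 - (1 - x) q\<close>.\<close>

lemma prob_few_hits_le:
  fixes x q :: real
  assumes "finite A" "card A \<le> N" "l \<le> card A" and x: "0 < x" "x < 1" and q: "0 < q"
    and "real r + q * real N \<le> real (card (B \<inter> A))"
  shows "measure_pmf.prob (pmf_of_set (permutations_of_set A)) {xs. card (B \<inter> set (take l xs)) < r}
    \<le> (1 / x) ^ r * (1 - (1 - x) * q) ^ l"
  using assms(1,2,3,7)
proof (induction l arbitrary: A r)
  case 0
  show ?case
  proof (cases "r = 0")
    case False
    have "measure_pmf.prob (pmf_of_set (permutations_of_set A))
        {xs. card (B \<inter> set (take 0 xs)) < r} \<le> 1"
      by (rule measure_pmf.prob_le_1)
    also have "\<dots> \<le> (1 / x) ^ r"
      using x by (intro one_le_power) simp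
    finally show ?thesis
      by simp
  qed simp
next
  case (Suc l)
  define z where "z = 1 - (1 - x) * q"
  have A: "A \<noteq> {}" "0 < card A"
    using Suc.prems by (auto simp: card_gt_0_iff)
  have N: "0 < real N"
    using A Suc.prems by linarith
  have cBA: "card (B \<inter> A) \<le> card A"
    using Suc.prems by (intro card_mono) auto
  have "q * real N \<le> 1 * real N"
    using Suc.prems cBA by linarith
  then have q1: "q \<le> 1"
    using N by (simp add: mult_le_cancel_right)
  have z: "0 < z"
  proof -
    have "(1 - x) * q \<le> 1 - x"
      using x q q1 by (intro mult_left_le) auto
    then show ?thesis
      unfolding z_def using x by linarith
  qed
  show ?case
  proof (cases "r = 0")
    case True
    then show ?thesis
      using x z by (simp add: z_def[symmetric])
  next
    case False
    then obtain r' where r: "r = Suc r'"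
      by (cases r) auto
    let ?K = "(1 / x) ^ r * z ^ l"
    let ?P = "\<lambda>a. measure_pmf.prob (pmf_of_set (permutations_of_set (A - {a})))
      {xs. card (B \<inter> set (take (Suc l) (a # xs))) < r}"
    \<comment> \<open>\<open>N\<close> stays fixed while \<open>A\<close> shrinks. The invariant
      \<open>r + q N <= card (B \<inter> A)\<close> survives: a hit lowers both sides by 1, a miss
      leaves both unchanged. As \<open>card A <= N\<close>, it also forces a hit probability of at
      least \<open>q\<close>.\<close>
    have step: "?P a \<le> ?K * (1 - (1 - x) * of_bool (a \<in> B))" if a: "a \<in> A" for a
    proof -
      have fin: "finite (A - {a})" "card (A - {a}) \<le> N" "l \<le> card (A - {a})"
        using Suc.prems a by auto
      have perm: "set_pmf (pmf_of_set (permutations_of_set (A - {a}))) = permutations_of_set (A - {a})"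
        using Suc.prems by (intro set_pmf_of_set) auto
      show ?thesis
      proof (cases "a \<in> B")
        case True
        have "?P a = measure_pmf.prob (pmf_of_set (permutations_of_set (A - {a})))
            {xs. card (B \<inter> set (take l xs)) < r'}"
        proof (intro measure_pmf.finite_measure_eq_AE)
          show "AE xs in measure_pmf (pmf_of_set (permutations_of_set (A - {a}))).
            (xs \<in> {xs. card (B \<inter> set (take (Suc l) (a # xs))) < r})
            = (xs \<in> {xs. card (B \<inter> set (take l xs)) < r'})"
            unfolding AE_measure_pmf_iff perm
          proof
            fix xs assume "xs \<in> permutations_of_set (A - {a})"
            then have "a \<notin> set (take l xs)"
              by (auto dest!: in_set_takeD permutations_of_setD(1))
            then show "(xs \<in> {xs. card (B \<inter> set (take (Suc l) (a # xs))) < r})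
              = (xs \<in> {xs. card (B \<inter> set (take l xs)) < r'})"
              using True r by simp
          qed
        qed auto
        also have "\<dots> \<le> (1 / x) ^ r' * z ^ l"
        proof -
          have "card (B \<inter> A) = Suc (card (B \<inter> (A - {a})))"
            using Suc.prems(1) a True card_Suc_Diff1[of "B \<inter> A" a] by (simp add: Int_Diff)
          then show ?thesis
            using Suc.IH[OF fin, of r'] Suc.prems(4) r by (simp add: z_def)
        qed
        also have "\<dots> = ?K * x"
          using x r by simp
        finally show ?thesis
          using True by simp
      next
        case False
        then have "B \<inter> (A - {a}) = B \<inter> A" "?P a = measure_pmf.prob
            (pmf_of_set (permutations_of_set (A - {a}))) {xs. card (B \<inter> set (take l xs)) < r}"
          by auto
        then show ?thesis
          using Suc.IH[OF fin, of r] Suc.prems(4) False by (simp add: z_def)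
      qed
    qed
    have "measure_pmf.prob (pmf_of_set (permutations_of_set A))
        {xs. card (B \<inter> set (take (Suc l) xs)) < r}
      = measure_pmf.expectation (pmf_of_set A) ?P"
    proof -
      have "measure_pmf.prob (pmf_of_set (permutations_of_set A))
          {xs. card (B \<inter> set (take (Suc l) xs)) < r}
        = measure_pmf.expectation (pmf_of_set A \<bind>
            (\<lambda>a. map_pmf ((#) a) (pmf_of_set (permutations_of_set (A - {a})))))
          (indicator {xs. card (B \<inter> set (take (Suc l) xs)) < r})"
        using random_permutation_of_set[OF Suc.prems(1) A(1)] by (simp add: map_pmf_def)
      also have "\<dots> = measure_pmf.expectation (pmf_of_set A) (\<lambda>a.
          measure_pmf.expectation (map_pmf ((#) a) (pmf_of_set (permutations_of_set (A - {a}))))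
          (indicator {xs. card (B \<inter> set (take (Suc l) xs)) < r}))"
        using Suc.prems(1) A(1)
        by (intro expectation_bind_finite) (simp_all add: set_pmf_of_set)
      also have "\<dots> = measure_pmf.expectation (pmf_of_set A) ?P"
        by (simp add: vimage_def)
      finally show ?thesis .
    qed
    also have "\<dots> \<le> measure_pmf.expectation (pmf_of_set A) (\<lambda>a. ?K * (1 - (1 - x) * of_bool (a \<in> B)))"
      using Suc.prems(1) A(1) step by (intro expectation_mono_finite) (auto simp: set_pmf_of_set)
    also have "\<dots> = ?K * (1 - (1 - x) * (real (card (B \<inter> A)) / real (card A)))"
    proof -
      have "(\<Sum>a\<in>A. of_bool (a \<in> B) :: real) = real (card (B \<inter> A))"
        using Suc.prems(1) by (simp add: of_bool_def sum.If_cases Int_commute)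
      then show ?thesis
        using Suc.prems(1) A
        by (simp add: integral_pmf_of_set sum_distrib_left[symmetric] sum_subtractf diff_divide_distrib)
    qed
    also have "\<dots> \<le> ?K * z"
    proof (intro mult_left_mono)
      have "q * real (card A) \<le> q * real N"
        using Suc.prems(2) q by simp
      also have "\<dots> \<le> real (card (B \<inter> A))"
        using Suc.prems(4) by linarith
      finally have "q \<le> real (card (B \<inter> A)) / real (card A)"
        using A by (simp add: field_simps)
      then have "(1 - x) * q \<le> (1 - x) * (real (card (B \<inter> A)) / real (card A))"
        using x by (intro mult_left_mono) auto
      then show "1 - (1 - x) * (real (card (B \<inter> A)) / real (card A)) \<le> z"
        by (simp add: z_def)
    qed (use x z in auto)
    finally show ?thesis
      by (simp add: z_def mult_ac)
  qed
qed

section \<open>Slack of the vertices in a random order\<close>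

text \<open>Reversal preserves the uniform distribution and turns the last \<open>l\<close> elements
  into the first \<open>l\<close>. The previous bound is applied with \<open>x = 1 / 2\<close> and
  half the density of \<open>B\<close> as \<open>q\<close>.\<close>

lemma prob_few_late_elements_le:
  fixes n l :: nat
  assumes B: "B \<subseteq> {1..n}" "3 \<le> card B" and l: "l \<le> n"
  defines "y \<equiv> real (card B) * real l / (8 * real n)"
  shows "measure_pmf.prob (pmf_of_set (permutations_of_set {1..n}))
    {\<pi>. real (card (B \<inter> set (drop (n - l) \<pi>))) < y} \<le> 2 * exp (- y)"
proof -
  let ?P = "pmf_of_set (permutations_of_set {1..n})"
  define q where "q = real (card B) / (2 * real n)"
  define r where "r = nat \<lceil>y\<rceil>"
  have cB: "card B \<le> n"
    using card_mono[OF _ B(1)] by simp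
  then have n: "0 < n"
    using B by simp
  have "real (card B) * real l \<le> real (card B) * real n"
    using l by (intro mult_left_mono) auto
  then have y: "0 \<le> y" "y \<le> real (card B) / 8"
    using n by (auto simp: y_def field_simps)
  have r: "real r \<le> y + 1" "y \<le> real r"
    using y by (auto simp: r_def)
  have rev: "map_pmf rev ?P = ?P"
    by (subst map_pmf_of_set_inj) auto
  have "measure_pmf.prob ?P {\<pi>. real (card (B \<inter> set (drop (n - l) \<pi>))) < y}
      = measure_pmf.prob (map_pmf rev ?P) {\<pi>. real (card (B \<inter> set (drop (n - l) \<pi>))) < y}"
    by (simp only: rev)
  also have "\<dots> = measure_pmf.prob ?P {\<pi>. real (card (B \<inter> set (drop (n - l) (rev \<pi>)))) < y}"
    by (simp add: vimage_def)
  also have "\<dots> \<le> measure_pmf.prob ?P {\<pi>. card (B \<inter> set (take l \<pi>)) < r}"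
  proof (intro measure_pmf.finite_measure_mono_AE)
    show "AE \<pi> in measure_pmf ?P. \<pi> \<in> {\<pi>. real (card (B \<inter> set (drop (n - l) (rev \<pi>)))) < y}
      \<longrightarrow> \<pi> \<in> {\<pi>. card (B \<inter> set (take l \<pi>)) < r}"
    proof (subst AE_measure_pmf_iff, intro ballI impI)
      fix \<pi>
      assume "\<pi> \<in> set_pmf ?P"
        and hits: "\<pi> \<in> {\<pi>. real (card (B \<inter> set (drop (n - l) (rev \<pi>)))) < y}"
      then have "\<pi> \<in> permutations_of_set {1..n}"
        by (subst (asm) set_pmf_of_set) auto
      then have "length \<pi> = n"
        using length_finite_permutations_of_set by fastforce
      then have "set (drop (n - l) (rev \<pi>)) = set (take l \<pi>)"
        using l by (simp add: drop_rev)
      then have "real (card (B \<inter> set (take l \<pi>))) < real r"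
        using hits r(2) by simp
      then show "\<pi> \<in> {\<pi>. card (B \<inter> set (take l \<pi>)) < r}"
        by simp
    qed
  qed simp
  also have "\<dots> \<le> (1 / (1 / 2)) ^ r * (1 - (1 - 1 / 2) * q) ^ l"
  proof (rule prob_few_hits_le[where N = n])
    have "B \<inter> {1..n} = B"
      using B by blast
    moreover have "q * real n = real (card B) / 2"
      using n by (simp add: q_def)
    \<comment> \<open>The left side is at most \<open>card B / 8 + 1 + card B / 2\<close>; this is
      where \<open>B\<close> must have at least 3 elements.\<close>
    ultimately show "real r + q * real n \<le> real (card (B \<inter> {1..n}))"
      using r(1) y(2) B(2) by simp
    show "0 < q"
      using B(2) n by (simp add: q_def)
  qed (use l in auto)
  \<comment> \<open>Since \<open>r <= y + 1\<close>, the first factor is at most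
    \<open>2 * 2^y\<close>, hence at most \<open>2 * exp y\<close>. The exponent
    \<open>q l / 2\<close> of the second equals \<open>2 y\<close>.\<close>
  also have "\<dots> \<le> (2 * exp y) * exp (- (2 * y))"
  proof (intro mult_mono)
    have "(1 / (1 / 2) :: real) ^ r = exp (real r * ln 2)"
      by (simp add: exp_of_nat_mult)
    also have "\<dots> \<le> exp (ln 2 + y)"
    proof -
      have "real r * ln 2 \<le> (y + 1) * ln 2"
        using r by (intro mult_right_mono) auto
      also have "\<dots> \<le> y + ln 2"
        using y mult_left_le[of "ln 2" y] ln_2_less_1 by (simp add: distrib_right)
      finally show ?thesis
        by simp
    qed
    finally show "(1 / (1 / 2) :: real) ^ r \<le> 2 * exp y"
      by (simp add: exp_add)
    have q: "q \<le> 1"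
      using cB n by (simp add: q_def)
    then show "0 \<le> (1 - (1 - 1 / 2) * q) ^ l"
      by simp
    have "(1 - (1 - 1 / 2) * q) ^ l \<le> exp (- (q / 2)) ^ l"
      using q exp_ge_add_one_self[of "- (q / 2)"] by (intro power_mono) auto
    also have "\<dots> = exp (- (2 * y))"
      by (simp add: exp_of_nat_mult[symmetric] y_def q_def)
    finally show "(1 - (1 - 1 / 2) * q) ^ l \<le> exp (- (2 * y))" .
  qed auto
  also have "\<dots> = 2 * exp (- y)"
    by (simp add: mult_exp_exp)
  finally show ?thesis .
qed

text \<open>Here \<open>t\<close> is the fraction of the vertices which come last and for which no bound on the slack
  is needed.\<close>

definition well_spread :: "nat \<Rightarrow> nat \<Rightarrow> nat set set \<Rightarrow> real \<Rightarrow> nat list set" where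
  "well_spread n m E t = {\<pi>. \<forall>l\<in>{1..n}. \<forall>v\<in>{1..n}.
     t * real n \<le> real l \<longrightarrow> m \<le> 2 * card (nbhd E v) \<longrightarrow>
     real (card (nbhd E v)) * real l / (8 * real n) \<le> real (card (nbhd E v \<inter> set (drop (n - l) \<pi>)))}"

lemma nbhd_subset: "simple_graph n E \<Longrightarrow> nbhd E v \<subseteq> {1..n} - {v}"
  by (auto simp: simple_graph_def nbhd_def)

text \<open>A union bound over at most \<open>n^2\<close> pairs of \<open>l\<close> and
  \<open>v\<close>. Degree at least \<open>m / 2\<close> and \<open>l >= t n\<close> make each
  exponent at least \<open>(m / 2) t / 8\<close>, and \<open>6 <= m\<close> makes the degree at
  least 3.\<close>

lemma prob_not_well_spread_le:
  assumes E: "simple_graph n E" and m: "6 \<le> m" and t: "0 \<le> t"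
  shows "measure_pmf.prob (pmf_of_set (permutations_of_set {1..n})) (- well_spread n m E t)
    \<le> 2 * (real n)\<^sup>2 * exp (- (real m * t / 16))"
proof -
  let ?P = "pmf_of_set (permutations_of_set {1..n})"
  let ?y = "\<lambda>l v. real (card (nbhd E v)) * real l / (8 * real n)"
  let ?I = "{lv\<in>{1..n} \<times> {1..n}. t * real n \<le> real (fst lv) \<and> m \<le> 2 * card (nbhd E (snd lv))}"
  let ?A = "\<lambda>lv. {\<pi>. real (card (nbhd E (snd lv) \<inter> set (drop (n - fst lv) \<pi>))) < ?y (fst lv) (snd lv)}"
  have "- well_spread n m E t \<subseteq> (\<Union>lv\<in>?I. ?A lv)"
    by (fastforce simp: well_spread_def not_le)
  then have "measure_pmf.prob ?P (- well_spread n m E t) \<le> measure_pmf.prob ?P (\<Union>lv\<in>?I. ?A lv)"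
    by (intro measure_pmf.finite_measure_mono) auto
  also have "\<dots> \<le> (\<Sum>lv\<in>?I. measure_pmf.prob ?P (?A lv))"
    by (intro measure_pmf.finite_measure_subadditive_finite) auto
  also have "\<dots> \<le> (\<Sum>lv\<in>?I. 2 * exp (- (real m * t / 16)))"
  proof (intro sum_mono)
    fix lv assume lv: "lv \<in> ?I"
    obtain l v where lv': "lv = (l, v)"
      by (cases lv)
    have *: "l \<in> {1..n}" "v \<in> {1..n}" "t * real n \<le> real l" "m \<le> 2 * card (nbhd E v)"
      using lv by (auto simp: lv')
    have "measure_pmf.prob ?P (?A lv) \<le> 2 * exp (- ?y l v)"
      using prob_few_late_elements_le[of "nbhd E v" n l] * m nbhd_subset[OF E, of v] by (auto simp: lv')
    also have "real m * t / 16 \<le> ?y l v"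
    proof -
      have "(real m / 2) * (t * real n) \<le> real (card (nbhd E v)) * real l"
        using * t by (intro mult_mono) auto
      then show ?thesis
        using * by (simp add: field_simps)
    qed
    then have "2 * exp (- ?y l v) \<le> 2 * exp (- (real m * t / 16))"
      by simp
    finally show "measure_pmf.prob ?P (?A lv) \<le> 2 * exp (- (real m * t / 16))" .
  qed
  also have "\<dots> = real (card ?I) * (2 * exp (- (real m * t / 16)))"
    by simp
  also have "\<dots> \<le> (real n)\<^sup>2 * (2 * exp (- (real m * t / 16)))"
  proof (intro mult_right_mono)
    have "card ?I \<le> card ({1..n} \<times> {1..n})"
      by (intro card_mono) auto
    then have "card ?I \<le> n * n"
      by (simp only: card_cartesian_product card_atLeastAtMost) simp
    then have "real (card ?I) \<le> real (n * n)"
      by (rule of_nat_mono)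
    then show "real (card ?I) \<le> (real n)\<^sup>2"
      by (simp only: of_nat_mult power2_eq_square)
  qed simp
  finally show ?thesis
    by simp
qed

text \<open>The degree is below \<open>m\<close>, so the slack exceeds the number of neighbors from
  position \<open>i\<close> on. The constant 16 combines the factor 8 of \<open>well_spread\<close>
  with the degree threshold \<open>m / 2\<close>; below that threshold the slack is at least
  \<open>m / 2\<close> outright.\<close>

lemma well_spread_slack:
  assumes E: "simple_graph n E" and deg: "\<And>v. v \<in> {1..n} \<Longrightarrow> card (nbhd E v) < m"
    and \<pi>: "\<pi> \<in> permutations_of_set {1..n}" "\<pi> \<in> well_spread n m E t"
    and i: "i < n" "t * real n \<le> real (n - i)"
  shows "real m * real (n - i) / (16 * real n)
    \<le> real m - real (card (nbhd E (\<pi> ! i) \<inter> set (take i \<pi>)))"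
proof -
  define B where "B = nbhd E (\<pi> ! i)"
  have len: "length \<pi> = n" and set: "set \<pi> = {1..n}" and dist: "distinct \<pi>"
    using \<pi>(1) length_finite_permutations_of_set[OF \<pi>(1)]
    by (auto simp: permutations_of_setD)
  have v: "\<pi> ! i \<in> {1..n}"
    using i len set nth_mem by metis
  have B: "B \<subseteq> {1..n}" "finite B"
    using nbhd_subset[OF E] finite_subset by (auto simp: B_def) blast
  have disj: "set (take i \<pi>) \<inter> set (drop i \<pi>) = {}"
    using dist by (simp add: set_take_disj_set_drop_if_distinct)
  have "B = (B \<inter> set (take i \<pi>)) \<union> (B \<inter> set (drop i \<pi>))"
    using B(1) set by (metis Int_Un_distrib append_take_drop_id inf.absorb_iff1 set_append)
  then have "card B = card (B \<inter> set (take i \<pi>)) + card (B \<inter> set (drop i \<pi>))"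
    using B(2) disj by (subst card_Un_disjoint[symmetric]) auto
  then have split: "real (card B) = real (card (B \<inter> set (take i \<pi>))) + real (card (B \<inter> set (drop i \<pi>)))"
    by simp
  have ratio: "real (n - i) / real n \<le> 1"
    using i by simp
  show ?thesis
  proof (cases "m \<le> 2 * card B")
    case True
    have "real (card B) * real (n - i) / (8 * real n) \<le> real (card (B \<inter> set (drop (n - (n - i)) \<pi>)))"
    proof -
      have "n - i \<in> {1..n}"
        using i by auto
      then show ?thesis
        using \<pi>(2) v i(2) True unfolding well_spread_def B_def by blast
    qed
    moreover have "(real m / 2) * (real (n - i) / (8 * real n)) \<le> real (card B) * (real (n - i) / (8 * real n))"
      using True by (intro mult_right_mono) auto
    ultimately have "real m * real (n - i) / (16 * real n) \<le> real (card (B \<inter> set (drop i \<pi>)))"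
      using i by simp
    moreover have "card B < m"
      using deg[OF v] by (simp add: B_def)
    ultimately show ?thesis
      using split by (simp add: B_def)
  next
    case False
    have "real m * (real (n - i) / real n) \<le> real m * 1"
      using ratio by (intro mult_left_mono) auto
    then have "real m * real (n - i) / (16 * real n) \<le> real m / 16"
      by simp
    moreover have "real (card (B \<inter> set (take i \<pi>))) \<le> real m / 2"
      using False split by simp
    moreover have "0 \<le> real m"
      by simp
    ultimately show ?thesis
      unfolding B_def by argo
  qed
qed

section \<open>Concentration of the total cost\<close>

text \<open>Telescoping: \<open>1 / sqrt (n + 1)\<close> is at most
  \<open>2 (sqrt (n + 1) - sqrt n)\<close>.\<close>

lemma sum_inverse_sqrt_le: "(\<Sum>l=1..n. 1 / sqrt (real l)) \<le> 2 * sqrt (real n)"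
proof (induction n)
  case (Suc n)
  let ?a = "sqrt (real n)" and ?b = "sqrt (real (Suc n))"
  have b: "0 < ?b" "?a \<le> ?b" "0 \<le> ?a"
    by auto
  have "1 = ?b\<^sup>2 - ?a\<^sup>2"
    by simp
  also have "\<dots> = (?b - ?a) * (?b + ?a)"
    by (simp only: power2_eq_square square_diff_square_factored mult.commute)
  also have "\<dots> \<le> (?b - ?a) * (2 * ?b)"
    using b by (intro mult_left_mono) auto
  finally have "1 \<le> 2 * (?b - ?a) * ?b"
    by argo
  then have "1 / ?b \<le> 2 * (?b - ?a)"
    using b(1) by (subst pos_divide_le_eq)
  then show ?case
    using Suc.IH by simp
qed simp

lemma expectation_exp_color_vertices_well_spread:
  assumes h: "halving h" and E: "simple_graph n (EA \<union> EB)" "EA \<inter> EB = {}"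
    and deg: "\<And>v. v \<in> {1..n} \<Longrightarrow> card (nbhd (EA \<union> EB) v) < m"
    and n: "0 < n" and t: "0 \<le> t"
    and \<pi>: "\<pi> \<in> permutations_of_set {1..n}" "\<pi> \<in> well_spread n m (EA \<union> EB) t"
    and l: "0 \<le> l" "l * (8 * (real (msg_bits {1..m}))\<^sup>2) \<le> 1"
  shows "measure_pmf.expectation (color_vertices h m EA EB \<pi> Map.empty) (\<lambda>r. exp (l * real (snd r)))
    \<le> exp (4928000 * l * real n + t * real n)"
proof -
  \<comment> \<open>\<open>G j\<close> bounds the logarithm of the factor of the vertex at which
    \<open>j\<close> vertices, itself included, remain. The constant is
    \<open>2 * 308000 * 4\<close>, with 4 the root of the slack constant 16. The at most
    \<open>t n\<close> late vertices get 1, since \<open>l\<close> times their cost never exceeds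
    1.\<close>
  define G where "G j = (if t * real n \<le> real j then 2464000 * l * sqrt (real n) * (1 / sqrt (real j)) else 1)"
    for j :: nat
  have len: "length \<pi> = n"
    using length_finite_permutations_of_set[OF \<pi>(1)] by simp
  have m: "0 < m"
    using deg[of 1] n by simp
  have "measure_pmf.expectation (color_vertices h m EA EB \<pi> Map.empty) (\<lambda>r. exp (l * real (snd r)))
      \<le> exp (\<Sum>i<length \<pi>. G (n - i))"
  proof (rule expectation_exp_color_vertices)
    fix i and X Y :: "nat set"
    assume i: "i < length \<pi>" and fin: "finite X" "finite Y" and XY: "card X + card Y
      \<le> card (nbhd (EA \<union> EB) (\<pi> ! i) \<inter> (dom (Map.empty :: nat \<rightharpoonup> nat) \<union> set (take i \<pi>)))"
    have "measure_pmf.expectation (find_color h m X Y (guesses m)) (\<lambda>ab. exp (l * real (snd ab)))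
      \<le> exp (2 * l * expected_cost h m X Y (guesses m))" if "t * real n \<le> real (n - i)"
      using expectation_exp_find_color[OF h m l] .
    moreover have "2 * l * expected_cost h m X Y (guesses m) \<le> G (n - i)" if it: "t * real n \<le> real (n - i)"
    proof -
      define k where "k = m - (card X + card Y)"
      have pos: "0 < real m * real (n - i) / (16 * real n)"
        using m n i len by simp
      have slack: "real m * real (n - i) / (16 * real n) \<le> real m - real (card X + card Y)"
        using well_spread_slack[OF E(1) deg \<pi>, of i] i len it XY by simp
      then have "card X + card Y < m"
        using pos by linarith
      then have k: "card X + card Y + k \<le> m" "0 < k" "real k = real m - real (card X + card Y)"
        by (auto simp: k_def)
      have "real m * real (n - i) / (16 * real n) \<le> real k"
        using slack unfolding k(3) .
      then have "real m * real (n - i) \<le> real k * (16 * real n)"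
        using n by (subst (asm) pos_divide_le_eq) auto
      moreover have "x / y \<le> 16 * (z / a)" if "x * a \<le> y * (16 * z)" "0 < y" "0 < a" for x y z a :: real
        using that by (simp add: field_simps)
      ultimately have "real m / real k \<le> 16 * (real n / real (n - i))"
        using k(2) i len by simp
      then have "sqrt (real m / real k) \<le> sqrt (16 * (real n / real (n - i)))"
        by (rule real_sqrt_le_mono)
      also have "\<dots> = 4 * (sqrt (real n) * (1 / sqrt (real (n - i))))"
        using real_sqrt_abs[of 4] by (simp only: real_sqrt_mult real_sqrt_divide) simp
      finally have "expected_cost h m X Y (guesses m)
          \<le> 308000 * (4 * (sqrt (real n) * (1 / sqrt (real (n - i)))))"
        using expected_cost_guesses[OF h k(1,2) fin] by simp
      then have "2 * l * expected_cost h m X Y (guesses m)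
          \<le> 2 * l * (308000 * (4 * (sqrt (real n) * (1 / sqrt (real (n - i))))))"
        using l by (intro mult_left_mono) auto
      then show ?thesis
        using it by (simp add: G_def)
    qed
    moreover have "measure_pmf.expectation (find_color h m X Y (guesses m)) (\<lambda>ab. exp (l * real (snd ab)))
      \<le> measure_pmf.expectation (find_color h m X Y (guesses m)) (\<lambda>ab. exp 1)"
    proof (intro expectation_mono_finite finite_set_find_color)
      fix ab assume "ab \<in> set_pmf (find_color h m X Y (guesses m))"
      then have "real (snd ab) \<le> real (8 * (msg_bits {1..m})\<^sup>2)"
        by (intro of_nat_mono find_color_guesses_max_cost[OF h m])
      then have "l * real (snd ab) \<le> l * (8 * (real (msg_bits {1..m}))\<^sup>2)"
        using l(1) by (intro mult_left_mono) auto
      then show "exp (l * real (snd ab)) \<le> exp 1"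
        using l(2) by simp
    qed
    ultimately show "measure_pmf.expectation (find_color h m X Y (guesses m)) (\<lambda>ab. exp (l * real (snd ab)))
      \<le> exp (G (n - i))"
      by (cases "t * real n \<le> real (n - i)") (auto simp: G_def intro: order_trans)
  next
    show "finite (nbhd (EA \<union> EB) v)" for v
      using nbhd_subset[OF E(1)] finite_subset by blast
  qed (use E in auto)
  also have "(\<Sum>i<length \<pi>. G (n - i)) = (\<Sum>j=1..n. G j)"
    unfolding len by (rule sum.reindex_bij_witness[of _ "\<lambda>j. n - j" "\<lambda>i. n - i"]) auto
  also have "(\<Sum>j=1..n. G j) \<le> (\<Sum>j=1..n. 2464000 * l * sqrt (real n) * (1 / sqrt (real j))
      + of_bool (real j < t * real n))"
    using l by (intro sum_mono) (auto simp: G_def)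
  also have "\<dots> = 2464000 * l * sqrt (real n) * (\<Sum>j=1..n. 1 / sqrt (real j))
      + real (card {j\<in>{1..n}. real j < t * real n})"
    by (simp add: sum.distrib sum_distrib_left of_bool_def sum.If_cases Int_def)
  also have "\<dots> \<le> 2464000 * l * sqrt (real n) * (2 * sqrt (real n)) + t * real n"
  proof (intro add_mono mult_left_mono sum_inverse_sqrt_le)
    have "card {j\<in>{1..n}. real j < t * real n} \<le> card {1..nat \<lfloor>t * real n\<rfloor>}"
      by (intro card_mono) (auto simp: le_nat_floor)
    also have "real \<dots> \<le> t * real n"
      using t by simp
    finally show "real (card {j\<in>{1..n}. real j < t * real n}) \<le> t * real n"
      by simp
  qed (use l in auto)
  also have "\<dots> = 4928000 * l * real n + t * real n"
    by simp
  finally show ?thesis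
    by simp
qed

text \<open>The two terms are the probability of an order that is not well spread and, for each
  well-spread order, the Markov bound on the exponential moment.\<close>

lemma prob_large_cost_le:
  assumes h: "halving h" and E: "simple_graph n (EA \<union> EB)" "EA \<inter> EB = {}"
    and deg: "\<And>v. v \<in> {1..n} \<Longrightarrow> card (nbhd (EA \<union> EB) v) \<le> \<Delta>"
    and n: "2 \<le> n" and \<Delta>: "5 \<le> \<Delta>" "\<Delta> < n"
  defines "L \<equiv> log 2 (real n)"
  shows "measure_pmf.prob (coloring_protocol h n \<Delta> EA EB) {r. 5000000 * real n < real (snd r)}
    \<le> 2 * (real n)\<^sup>2 * exp (- (real \<Delta> / (16 * L\<^sup>2))) + exp (- (real n / (72 * L\<^sup>2)))"
proof -
  let ?P = "pmf_of_set (permutations_of_set {1..n})"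
  let ?A = "{r. 5000000 * real n < real (snd (r :: (nat \<rightharpoonup> nat) \<times> nat))}"
  define m where "m = \<Delta> + 1"
  define t where "t = 1 / L\<^sup>2"
  \<comment> \<open>A message about the palette has at most \<open>3 L\<close> bits, and
    \<open>8 * (3 L)^2 = 72 L^2\<close> bounds the cost of one vertex.\<close>
  define l where "l = 1 / (72 * L\<^sup>2)"
  let ?W = "well_spread n m (EA \<union> EB) t"
  let ?C = "\<lambda>\<pi>. color_vertices h m EA EB \<pi> Map.empty"
  have L: "1 \<le> L"
    using n by (simp add: L_def le_log_iff)
  have J: "real (msg_bits {1..m}) \<le> 3 * L"
  proof -
    have "log 2 (real m + 1) \<le> log 2 (2 * real n)"
      using \<Delta> by (subst log_le_cancel_iff) (auto simp: m_def)
    also have "\<dots> = 1 + L"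
      using n by (simp add: L_def log_mult)
    finally show ?thesis
      using L unfolding msg_bits_def by (simp add: nat_le_iff) linarith
  qed
  have J2: "l * (8 * (real (msg_bits {1..m}))\<^sup>2) \<le> 1"
  proof -
    have "8 * (real (msg_bits {1..m}))\<^sup>2 \<le> 8 * (3 * L)\<^sup>2"
      using J by (intro mult_left_mono power_mono) auto
    then show ?thesis
      using L by (simp add: l_def power_mult_distrib)
  qed
  have l0: "0 < l" "t = 72 * l"
    using L by (auto simp: l_def t_def)
  have good: "measure_pmf.prob (?C \<pi>) ?A \<le> exp (- (l * real n))"
    if \<pi>: "\<pi> \<in> permutations_of_set {1..n}" "\<pi> \<in> ?W" for \<pi>
  proof -
    have "measure_pmf.prob (?C \<pi>) ?A \<le> measure_pmf.expectation (?C \<pi>)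
        (\<lambda>r. exp (- (l * (5000000 * real n))) * exp (l * real (snd r)))"
      using l0 by (intro prob_le_expectation) (auto simp: mult_exp_exp)
    also have "\<dots> = exp (- (l * (5000000 * real n)))
        * measure_pmf.expectation (?C \<pi>) (\<lambda>r. exp (l * real (snd r)))"
      by simp
    also have "\<dots> \<le> exp (- (l * (5000000 * real n))) * exp (4928000 * l * real n + t * real n)"
    proof (intro mult_left_mono expectation_exp_color_vertices_well_spread h E \<pi> J2)
      show "card (nbhd (EA \<union> EB) v) < m" if "v \<in> {1..n}" for v
        using deg[OF that] by (simp add: m_def)
    qed (use n l0 in auto)
    \<comment> \<open>As \<open>t = 72 l\<close>, the threshold 5000000 exceeds
      \<open>4928000 + 72\<close> by more than 1.\<close>
    also have "\<dots> \<le> exp (- (l * real n))"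
      using l0 n by (simp add: mult_exp_exp algebra_simps)
    finally show ?thesis .
  qed
  have "measure_pmf.prob (coloring_protocol h n \<Delta> EA EB) ?A
      = measure_pmf.expectation (coloring_protocol h n \<Delta> EA EB) (indicator ?A)"
    by simp
  also have "\<dots> = measure_pmf.expectation ?P (\<lambda>\<pi>. measure_pmf.expectation (?C \<pi>) (indicator ?A))"
    unfolding coloring_protocol_def m_def
    by (intro expectation_bind_finite) (simp_all add: set_pmf_of_set)
  also have "\<dots> \<le> measure_pmf.expectation ?P (\<lambda>\<pi>. indicator (- ?W) \<pi> + exp (- (l * real n)))"
  proof (intro expectation_mono_finite)
    fix \<pi> assume "\<pi> \<in> set_pmf ?P"
    then have \<pi>: "\<pi> \<in> permutations_of_set {1..n}"
      by (subst (asm) set_pmf_of_set) auto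
    show "measure_pmf.expectation (?C \<pi>) (indicator ?A) \<le> indicator (- ?W) \<pi> + exp (- (l * real n))"
    proof (cases "\<pi> \<in> ?W")
      case True
      then show ?thesis
        using good[OF \<pi>] by simp
    next
      case False
      have "measure_pmf.prob (?C \<pi>) ?A \<le> 1"
        by (rule measure_pmf.prob_le_1)
      also have "\<dots> \<le> 1 + exp (- (l * real n))"
        by simp
      finally show ?thesis
        using False by simp
    qed
  qed (simp add: set_pmf_of_set)
  also have "\<dots> = measure_pmf.prob ?P (- ?W) + exp (- (l * real n))"
    by (subst Bochner_Integration.integral_add)
       (auto intro!: integrable_measure_pmf_finite simp: set_pmf_of_set)
  also have "measure_pmf.prob ?P (- ?W) \<le> 2 * (real n)\<^sup>2 * exp (- (real m * t / 16))"
    using \<Delta> l0 by (intro prob_not_well_spread_le E) (auto simp: m_def)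
  also have "\<dots> \<le> 2 * (real n)\<^sup>2 * exp (- (real \<Delta> / (16 * L\<^sup>2)))"
    using L by (intro mult_left_mono) (auto simp: m_def t_def field_simps)
  finally show ?thesis
    by (simp add: l_def)
qed

section \<open>Iterated logarithm\<close>

text \<open>For \<open>x > 2\<close> one has \<open>log 2 x <= x - 1\<close>, so each logarithm
  lowers the integer bound \<open>N\<close> by 1. This makes the \<open>LEAST\<close> in
  \<open>log_star\<close> attained.\<close>

lemma iterated_log_le_1: "x \<le> real N \<Longrightarrow> \<exists>k. (log 2 ^^ k) x \<le> 1"
proof (induction N arbitrary: x)
  case 0
  then show ?case
    by (intro exI[of _ 0]) simp
next
  case (Suc N)
  show ?case
  proof (cases "x \<le> 2")
    case True
    show ?thesis
    proof (cases "x \<le> 1")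
      case True
      then show ?thesis
        by (intro exI[of _ 0]) simp
    next
      case False
      then show ?thesis
        using True by (intro exI[of _ 1]) (simp add: log_le_iff)
    qed
  next
    case False
    define u where "u = x / 2"
    have u: "1 < u" "x = 2 * u"
      using False by (auto simp: u_def)
    have "log 2 x = 1 + ln u / ln 2"
      using u by (simp add: log_mult log_def[of 2 u])
    also have "ln u / ln 2 \<le> (u - 1) / (1 / 2)"
      using u ln_le_minus_one[of u] ln2_ge_two_thirds by (intro frac_le) auto
    also have "1 + \<dots> = x - 1"
      using u by simp
    finally have "log 2 x \<le> real N"
      using Suc.prems by simp
    then obtain k where "(log 2 ^^ k) (log 2 x) \<le> 1"
      using Suc.IH by blast
    then have "(log 2 ^^ Suc k) x \<le> 1"
      by (simp only: funpow_Suc_right o_apply)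
    then show ?thesis
      by blast
  qed
qed

lemma log_star_ge_1:
  assumes "1 < x"
  shows "1 \<le> log_star x"
proof -
  obtain N where "x \<le> real N"
    using real_arch_simple by blast
  then obtain k where "(log 2 ^^ k) x \<le> 1"
    using iterated_log_le_1 by blast
  then have "(log 2 ^^ log_star x) x \<le> 1"
    unfolding log_star_def by (rule LeastI)
  then show ?thesis
    using assms by (cases "log_star x") auto
qed

theorem theorem4p11:
  fixes c :: real
  assumes "c > 0"
  shows "\<exists>(C :: real) (f :: nat \<Rightarrow> real).
    C > 0 \<and> f \<in> \<Theta>(\<lambda>n. sqrt (real n) / (log 2 (real n)) ^ 5) \<and>
    (\<forall>\<^sub>F n in sequentially. \<forall>\<Delta> E EA EB h.
       simple_graph n E \<longrightarrow> max_degree n E = \<Delta> \<longrightarrow>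
       EA \<union> EB = E \<longrightarrow> EA \<inter> EB = {} \<longrightarrow> halving h \<longrightarrow>
       real \<Delta> \<ge> sqrt (real n) / (c * (log 2 (real n)) ^ 3) \<longrightarrow>
       measure_pmf.prob (coloring_protocol h n \<Delta> EA EB)
         {(\<phi>, b). real b \<le> C * real n * real (log_star (real \<Delta>))}
       \<ge> 1 - exp (- f n))"
proof -
  let ?L = "\<lambda>n :: nat. log 2 (real n)"
  \<comment> \<open>With this constant the lower bound on \<open>\<Delta>\<close> gives
    \<open>\<Delta> / (16 L^2) >= 2 f n\<close>, leaving one copy of \<open>f n\<close> to absorb
    the polynomial factor.\<close>
  define f where "f = (\<lambda>n. 1 / (32 * c) * (sqrt (real n) / ?L n ^ 5))"
  have f: "f \<in> \<Theta>(\<lambda>n. sqrt (real n) / ?L n ^ 5)"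
    unfolding f_def using assms by (intro landau_theta.cmult_in_iff[THEN iffD2]) auto
  \<comment> \<open>Of the three asymptotic facts, the first absorbs the factor \<open>2 n^2\<close>
    of the union bound, the second makes the concentration term at most
    \<open>exp (- f n) / 2\<close>, and the third yields \<open>\<Delta> >= 5\<close>.\<close>
  have "\<forall>\<^sub>F n in sequentially. ln (4 * (real n)\<^sup>2) \<le> f n"
    unfolding f_def using assms by real_asymp
  moreover have "\<forall>\<^sub>F n in sequentially. f n + ln 2 \<le> real n / (72 * (?L n)\<^sup>2)"
    unfolding f_def using assms by real_asymp
  moreover have "\<forall>\<^sub>F n in sequentially. 5 \<le> sqrt (real n) / (c * ?L n ^ 3)"
    using assms by real_asymp
  ultimately have "\<forall>\<^sub>F n in sequentially. \<forall>\<Delta> E EA EB h.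
       simple_graph n E \<longrightarrow> max_degree n E = \<Delta> \<longrightarrow>
       EA \<union> EB = E \<longrightarrow> EA \<inter> EB = {} \<longrightarrow> halving h \<longrightarrow>
       real \<Delta> \<ge> sqrt (real n) / (c * ?L n ^ 3) \<longrightarrow>
       measure_pmf.prob (coloring_protocol h n \<Delta> EA EB)
         {(\<phi>, b). real b \<le> 5000000 * real n * real (log_star (real \<Delta>))}
       \<ge> 1 - exp (- f n)"
    using eventually_ge_at_top[of 2]
  proof eventually_elim
    case (elim n)
    show ?case
    proof (intro allI impI)
      fix \<Delta> E EA EB h
      assume E: "simple_graph n E" and max: "max_degree n E = \<Delta>" and part: "EA \<union> EB = E" "EA \<inter> EB = {}"
        and h: "halving h" and large: "real \<Delta> \<ge> sqrt (real n) / (c * ?L n ^ 3)"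
      let ?P = "coloring_protocol h n \<Delta> EA EB"
      have n: "2 \<le> n"
        using elim by simp
      have L: "1 \<le> ?L n"
        using n by (simp add: le_log_iff)
      have \<Delta>5: "5 \<le> \<Delta>"
        using elim large by linarith
      have deg: "card (nbhd E v) \<le> \<Delta>" if "v \<in> {1..n}" for v
        using that max by (auto simp: max_degree_def)
      have "\<Delta> \<in> (\<lambda>v. card (nbhd E v)) ` {1..n}"
        unfolding max[symmetric] max_degree_def using elim by (intro Max_in) auto
      then obtain v where v: "v \<in> {1..n}" "\<Delta> = card (nbhd E v)"
        by blast
      \<comment> \<open>A vertex is not its own neighbor, since edges have two elements.\<close>
      then have "\<Delta> \<le> card ({1..n} - {v})"
        using nbhd_subset[OF E, of v] by (metis card_mono finite_Diff finite_atLeastAtMost)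
      then have \<Delta>n: "\<Delta> < n"
        using v elim by auto
      have "measure_pmf.prob ?P {r. 5000000 * real n < real (snd r)}
          \<le> 2 * (real n)\<^sup>2 * exp (- (real \<Delta> / (16 * (?L n)\<^sup>2))) + exp (- (real n / (72 * (?L n)\<^sup>2)))"
        using E part deg elim \<Delta>5 \<Delta>n by (intro prob_large_cost_le h) auto
      also have "\<dots> \<le> exp (- f n) / 2 + exp (- f n) / 2"
      proof (intro add_mono)
        have "2 * f n = sqrt (real n) / (c * ?L n ^ 3) / (16 * (?L n)\<^sup>2)"
          using assms L by (simp add: f_def power_add[symmetric])
        also have "\<dots> \<le> real \<Delta> / (16 * (?L n)\<^sup>2)"
          using large by (intro divide_right_mono) auto
        finally have "exp (- (real \<Delta> / (16 * (?L n)\<^sup>2))) \<le> exp (- f n) * exp (- f n)"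
          by (simp add: mult_exp_exp)
        \<comment> \<open>The second copy of \<open>exp (- f n)\<close> is traded for
          \<open>1 / (4 n^2)\<close>.\<close>
        also have "\<dots> \<le> exp (- f n) * exp (- ln (4 * (real n)\<^sup>2))"
          using elim by (intro mult_left_mono) auto
        also have "\<dots> = exp (- f n) / (4 * (real n)\<^sup>2)"
        proof -
          have "exp (ln (4 * (real n)\<^sup>2)) = 4 * (real n)\<^sup>2"
            using n by (intro exp_ln) simp
          then show ?thesis
            by (simp only: exp_minus divide_inverse)
        qed
        finally show "2 * (real n)\<^sup>2 * exp (- (real \<Delta> / (16 * (?L n)\<^sup>2))) \<le> exp (- f n) / 2"
          using n by (simp add: field_simps)
        have "- (real n / (72 * (?L n)\<^sup>2)) \<le> - f n - ln 2"
          using elim(2) by linarith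
        then have "exp (- (real n / (72 * (?L n)\<^sup>2))) \<le> exp (- f n - ln 2)"
          by simp
        then show "exp (- (real n / (72 * (?L n)\<^sup>2))) \<le> exp (- f n) / 2"
          by (simp add: exp_diff)
      qed
      finally have bad: "measure_pmf.prob ?P {r. 5000000 * real n < real (snd r)} \<le> exp (- f n)"
        by simp
      have star: "1 \<le> real (log_star (real \<Delta>))"
        using log_star_ge_1[of "real \<Delta>"] \<Delta>5 by simp
      have "5000000 * real n * 1 \<le> 5000000 * real n * real (log_star (real \<Delta>))"
        using star by (intro mult_left_mono) auto
      then have "- {r. 5000000 * real n < real (snd r)}
          \<subseteq> {(\<phi>, b). real b \<le> 5000000 * real n * real (log_star (real \<Delta>))}"
        by auto
      then have "measure_pmf.prob ?P (- {r. 5000000 * real n < real (snd r)})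
          \<le> measure_pmf.prob ?P {(\<phi>, b). real b \<le> 5000000 * real n * real (log_star (real \<Delta>))}"
        by (intro measure_pmf.finite_measure_mono) auto
      moreover have "measure_pmf.prob ?P (- {r. 5000000 * real n < real (snd r)})
          = 1 - measure_pmf.prob ?P {r. 5000000 * real n < real (snd r)}"
        using measure_pmf.prob_compl[of "{r. 5000000 * real n < real (snd r)}" ?P]
        by (simp add: Compl_eq_Diff_UNIV)
      ultimately show "measure_pmf.prob ?P
          {(\<phi>, b). real b \<le> 5000000 * real n * real (log_star (real \<Delta>))} \<ge> 1 - exp (- f n)"
        using bad by linarith
    qed
  qed
  then show ?thesis
    using f by (intro exI[of _ 5000000] exI[of _ f]) auto
qed

end
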